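(* Let $X$ be a metric space, let $\mu$ be a measure over $X$, let $\alpha>0$ and fix $A\subset X$. Assume: (1) $X$ is a diametrically regular metric space. (2) $\mu$ is both a regular measure and a Borel measure. (3) $(\mathcal F_b)_{\mu,\zeta_{b,\alpha}}$ covers $A$ finely. (4) $A$ is a Borel set. (5) $A$ has a countable covering whose elements are open and have finite $\mu$-measure. (6) The subset $\{x\in A:\mathfrak s^\alpha(\mu,x)=0\}$ is $\sigma$-finite with respect to $\mathcal S^\alpha$. (7) $\mu\llcorner A\ll\mathcal S^\alpha\llcorner A$. Then $\mathfrak s^\alpha(\mu,\cdot):A\to[0,+\infty]$ is Borel and for every Borel set $B\subset A$ we have $$\mu(B)=\int_B\mathfrak s^\alpha(\mu,x)\,d\mathcal S^\alpha(x).$$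
   Context: A "measure over $X$" is an outer measure defined on all subsets of $X$; measurability is in the sense of Carathéodory, and integrals are with respect to the restriction of the outer measure to its measurable sets. A measure $\mu$ over $X$ is regular if every $E\subset X$ is contained in a $\mu$-measurable set $E'$ with $\mu(E')=\mu(E)$; it is a Borel measure if all Borel sets are $\mu$-measurable. A set is $\sigma$-finite with respect to a measure over $X$ if it is covered by countably many sets of finite measure. $(\mu\llcorner A)(E)=\mu(A\cap E)$, and $\mu\llcorner A\ll\psi\llcorner A$ means that $\mu(N)=0$ for every $N\subset A$ with $\psi(N)=0$. For $x\in X$, $r>0$, $B(x,r)=\{y\in X:d(x,y)<r\}$ and $\mathbb B(x,r)=\{y\in X:d(x,y)\le r\}$ are the open and closed balls. $X$ is diametrically regular if for every $x\in X$ there exist $R_x>0$ and $\delta_x>0$ such that for every $y\in B(x,R_x)$ the function $(0,\delta_x)\ni r\mapsto\operatorname{diam}(B(y,r))$ is continuous. $\mathcal F_b$ is the family of all closed balls $\mathbb B(x,r)$ in $X$ ($x\in X$, $r>0$), $c_\alpha>0$ is a fixed constant, and $\zeta_{b,\alpha}:\mathcal F_b\to[0,+\infty)$ is $\zeta_{b,\alpha}(S)=c_\alpha\operatorname{diam}(S)^\alpha$. The $\alpha$-dimensional spherical measure is $\mathcal S^\alpha(R)=\sup_{\delta>0}\inf\sum_j\zeta_{b,\alpha}(E_j)$, the infimum being over all countable (possibly finite) families $\{E_j\}\subset\mathcal F_b$ covering $R$ with $\operatorname{diam}(E_j)\le\delta$ for all $j$ ($\inf\emptyset=+\infty$). $(\mathcal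 F_b)_{\mu,\zeta_{b,\alpha}}=\mathcal F_b\setminus\{S\in\mathcal F_b:\ \zeta_{b,\alpha}(S)=\mu(S)=0\ \text{or}\ \mu(S)=\zeta_{b,\alpha}(S)=+\infty\}$. A family $\mathcal G\subset\mathcal P(X)$ covers $A$ finely if for every $a\in A$ and $\epsilon>0$ there is $S\in\mathcal G$ with $a\in S$ and $\operatorname{diam}(S)<\epsilon$. The quotient function $Q:(\mathcal F_b)_{\mu,\zeta_{b,\alpha}}\to[0,+\infty]$ is $Q(S)=+\infty$ if $\zeta_{b,\alpha}(S)=0$ and $Q(S)=\mu(S)/\zeta_{b,\alpha}(S)$ if $\zeta_{b,\alpha}(S)>0$. For $x\in A$ the Federer density is $$\mathfrak s^\alpha(\mu,x)=\inf_{\epsilon>0}\sup\{Q(S): S\in(\mathcal F_b)_{\mu,\zeta_{b,\alpha}},\ x\in S,\ \operatorname{diam}(S)<\epsilon\}.$$ *)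

theory Defs
  imports "HOL-Analysis.Analysis"
begin

section \<open>Outer measures defined on all subsets\<close>

text \<open>
  The metric space is the universe of a type of class \<open>metric_space\<close>. A ``measure over'' it is an
  outer measure on all subsets, measurability being in the sense of Caratheodory.
\<close>

definition measure_over :: "('a set \<Rightarrow> ennreal) \<Rightarrow> bool" where
  "measure_over \<phi> \<longleftrightarrow> outer_measure_space UNIV \<phi>"

definition carath_sets :: "('a set \<Rightarrow> ennreal) \<Rightarrow> 'a set set" where
  "carath_sets \<phi> = lambda_system UNIV UNIV \<phi>"

definition carath_measure :: "('a set \<Rightarrow> ennreal) \<Rightarrow> 'a measure" where
  "carath_measure \<phi> = measure_of UNIV (carath_sets \<phi>) \<phi>"

lemma
  assumes "measure_over \<phi>"
  shows sets_carath_measure: "sets (carath_measure \<phi>) = carath_sets \<phi>"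
    and emeasure_carath_measure:
      "E \<in> carath_sets \<phi> \<Longrightarrow> emeasure (carath_measure \<phi>) E = \<phi> E"
proof -
  interpret sigma_algebra UNIV "UNIV :: 'a set set"
    using sigma_algebra_Pow[of UNIV] by simp
  have ms: "measure_space UNIV (carath_sets \<phi>) \<phi>"
    using assms unfolding measure_over_def carath_sets_def by (rule caratheodory_lemma)
  then interpret C: sigma_algebra UNIV "carath_sets \<phi>"
    by (simp add: measure_space_def)
  show s: "sets (carath_measure \<phi>) = carath_sets \<phi>"
    by (simp add: carath_measure_def)
  show "emeasure (carath_measure \<phi>) E = \<phi> E" if "E \<in> carath_sets \<phi>"
    by (rule emeasure_measure_of[OF carath_measure_def])
      (use ms s that in \<open>auto simp: measure_space_def\<close>)
qed

definition regular_measure :: "('a set \<Rightarrow> ennreal) \<Rightarrow> bool" where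
  "regular_measure \<phi> \<longleftrightarrow> (\<forall>E. \<exists>E'\<in>carath_sets \<phi>. E \<subseteq> E' \<and> \<phi> E' = \<phi> E)"

definition Borel_measure :: "('a::topological_space set \<Rightarrow> ennreal) \<Rightarrow> bool" where
  "Borel_measure \<phi> \<longleftrightarrow> sets borel \<subseteq> carath_sets \<phi>"

definition sigma_finite_set :: "('a set \<Rightarrow> ennreal) \<Rightarrow> 'a set \<Rightarrow> bool" where
  "sigma_finite_set \<phi> E \<longleftrightarrow> (\<exists>\<U>. countable \<U> \<and> E \<subseteq> \<Union>\<U> \<and> (\<forall>U\<in>\<U>. \<phi> U < \<infinity>))"

definition abs_continuous_on :: "'a set \<Rightarrow> ('a set \<Rightarrow> ennreal) \<Rightarrow> ('a set \<Rightarrow> ennreal) \<Rightarrow> bool" where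
  "abs_continuous_on A \<mu> \<psi> \<longleftrightarrow> (\<forall>N\<subseteq>A. \<psi> N = 0 \<longrightarrow> \<mu> N = 0)"

section \<open>Metric notions\<close>

text \<open>
  The library's \<open>diameter\<close> is real-valued and meaningful only for bounded sets. It is applied
  below to balls, except in \<open>covers_finely\<close>, where boundedness is therefore demanded explicitly.
\<close>

definition diametrically_regular :: "'a::metric_space itself \<Rightarrow> bool" where
  "diametrically_regular _ \<longleftrightarrow>
     (\<forall>x::'a. \<exists>R>0. \<exists>\<delta>>0. \<forall>y\<in>ball x R. continuous_on {0<..<\<delta>} (\<lambda>r. diameter (ball y r)))"

definition covers_finely :: "'a::metric_space set set \<Rightarrow> 'a set \<Rightarrow> bool" where
  "covers_finely \<G> A \<longleftrightarrow>
     (\<forall>a\<in>A. \<forall>\<epsilon>>0. \<exists>S\<in>\<G>. a \<in> S \<and> bounded S \<and> diameter S < \<epsilon>)"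

definition closed_balls :: "'a::metric_space set set" where
  "closed_balls = {cball x r | x r. 0 < r}"

section \<open>Spherical measure and Federer density\<close>

text \<open>In the following, \<open>c\<close> is the normalizing constant \<open>c\<^sub>\<alpha>\<close>.\<close>

definition zeta_b :: "real \<Rightarrow> real \<Rightarrow> 'a::metric_space set \<Rightarrow> ennreal" where
  "zeta_b c \<alpha> S = ennreal (c * diameter S powr \<alpha>)"

text \<open>A countable, possibly finite family is given by an index set \<open>J\<close> of natural numbers.\<close>

definition spherical_premeasure :: "real \<Rightarrow> real \<Rightarrow> real \<Rightarrow> 'a::metric_space set \<Rightarrow> ennreal" where
  "spherical_premeasure c \<alpha> \<delta> R =
     Inf {\<Sum>\<^sub>\<infinity>j\<in>J. zeta_b c \<alpha> (E j) | (J::nat set) E.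
            (\<forall>j\<in>J. E j \<in> closed_balls \<and> diameter (E j) \<le> \<delta>) \<and> R \<subseteq> (\<Union>j\<in>J. E j)}"

definition spherical_measure :: "real \<Rightarrow> real \<Rightarrow> 'a::metric_space set \<Rightarrow> ennreal" where
  "spherical_measure c \<alpha> R = (SUP \<delta>\<in>{0<..}. spherical_premeasure c \<alpha> \<delta> R)"

definition admissible_balls ::
  "('a::metric_space set \<Rightarrow> ennreal) \<Rightarrow> ('a set \<Rightarrow> ennreal) \<Rightarrow> 'a set set" where
  "admissible_balls \<mu> \<zeta> =
     closed_balls - {S \<in> closed_balls. \<zeta> S = 0 \<and> \<mu> S = 0 \<or> \<mu> S = \<infinity> \<and> \<zeta> S = \<infinity>}"

definition quotient_fun :: "('a set \<Rightarrow> ennreal) \<Rightarrow> ('a set \<Rightarrow> ennreal) \<Rightarrow> 'a set \<Rightarrow> ennreal" where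
  "quotient_fun \<mu> \<zeta> S = (if \<zeta> S = 0 then \<infinity> else \<mu> S / \<zeta> S)"

definition Federer_density ::
  "real \<Rightarrow> real \<Rightarrow> ('a::metric_space set \<Rightarrow> ennreal) \<Rightarrow> 'a \<Rightarrow> ennreal" where
  "Federer_density c \<alpha> \<mu> x =
     (INF \<epsilon>\<in>{0<..}. SUP S\<in>{S \<in> admissible_balls \<mu> (zeta_b c \<alpha>). x \<in> S \<and> diameter S < \<epsilon>}.
        quotient_fun \<mu> (zeta_b c \<alpha>) S)"

end

theory Submission
  imports Defs
begin

text \<open>
  Write \<open>s\<close> for the Federer density and \<open>\<psi>\<close> for the spherical measure. Diametric regularity lets a
  closed ball be enlarged slightly without changing its quotient much, so on suitable closed sets
  exhausting the space the superlevel sets of the scale-\<open>\<epsilon>\<close> density are relatively open, and \<open>s\<close> is Borel.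
  If \<open>s < t\<close> on \<open>E\<close>, covers of \<open>E\<close> by small balls give \<open>\<mu> E \<le> t * \<psi> E\<close>. If \<open>s > t\<close> on a Borel set \<open>E\<close>,
  a Vitali covering inside an open set \<open>V \<supseteq> E\<close> gives \<open>t * \<psi> E \<le> \<mu> V\<close>, and outer regularity lets \<open>V\<close>
  shrink to \<open>E\<close>. Cutting \<open>A\<close> into countably many pieces on which \<open>s\<close> varies by a factor at most
  \<open>q > 1\<close>, both inequalities compare \<open>\<mu>\<close> and \<open>\<integral> s d\<psi>\<close> up to the factor \<open>q\<close>; let \<open>q \<rightarrow> 1\<close>. The set
  \<open>s = 0\<close> is \<open>\<mu>\<close>-null by \<open>\<sigma>\<close>-finiteness, the set \<open>s = \<infinity>\<close> is \<open>\<psi>\<close>-null and hence \<open>\<mu>\<close>-null.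
\<close>

section \<open>Series of extended nonnegative reals\<close>

lemma ennreal_suminf_tail_less:
  fixes f :: "nat \<Rightarrow> ennreal"
  assumes "suminf f < \<infinity>" and "0 < e"
  obtains n where "(\<Sum>k. f (k + n)) < e"
proof -
  have "(\<lambda>n. suminf f - (\<Sum>k<n. f k)) \<longlonglongrightarrow> suminf f - suminf f"
    using assms(1) by (intro tendsto_diff_ennreal_general tendsto_const summable_LIMSEQ) auto
  then have "(\<lambda>n. suminf f - (\<Sum>k<n. f k)) \<longlonglongrightarrow> 0"
    using assms(1) by simp
  moreover have "suminf f - (\<Sum>k<n. f k) = (\<Sum>k. f (k + n))" for n
  proof -
    have "(\<Sum>k<n. f k) \<le> suminf f" by (intro sum_le_suminf) auto
    then have "(\<Sum>k<n. f k) < \<infinity>" using assms(1) by (rule le_less_trans)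
    moreover have "suminf f = (\<Sum>k. f (k + n)) + (\<Sum>k<n. f k)"
      by (rule suminf_offset) simp
    ultimately show ?thesis by (metis ennreal_add_diff_cancel_right infinity_ennreal_def less_irrefl)
  qed
  ultimately have "eventually (\<lambda>n. (\<Sum>k. f (k + n)) < e) sequentially"
    using assms(2) by (auto dest: order_tendstoD(2))
  then show ?thesis using that by (auto simp: eventually_sequentially)
qed

text \<open>The spherical premeasure is built from unordered sums over index sets. Padding with
  zeros turns them into ordinary series, for which tails, termwise comparison and double series are
  at hand.\<close>

lemma infsum_ennreal_eq_suminf:
  fixes f :: "nat \<Rightarrow> ennreal"
  shows "infsum f J = (\<Sum>j. if j \<in> J then f j else 0)"
proof -
  have "infsum f J = infsum (\<lambda>j. if j \<in> J then f j else 0) UNIV"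
    by (intro infsum_cong_neutral) auto
  also have "\<dots> = (\<Sum>j. if j \<in> J then f j else 0)"
  proof (rule sums_unique)
    let ?g = "\<lambda>j. if j \<in> J then f j else 0"
    have "(sum ?g \<longlongrightarrow> infsum ?g UNIV) (finite_subsets_at_top UNIV)"
      using has_sum_infsum[OF nonneg_summable_on_complete, of UNIV ?g] by (simp add: has_sum_def)
    \<comment> \<open>The initial segments \<open>{..<n}\<close> are cofinal among the finite sets
      of naturals, so convergence of the net of finite sums gives convergence of the partial
      sums.\<close>
    then show "?g sums infsum ?g UNIV"
      unfolding sums_def by (rule filterlim_compose[OF _ filterlim_lessThan_at_top])
  qed
  finally show ?thesis .
qed

section \<open>Outer measures\<close>

lemma measure_over_empty: "measure_over \<phi> \<Longrightarrow> \<phi> {} = 0"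
  by (auto simp: measure_over_def outer_measure_space_def positive_def)

lemma measure_over_mono: "measure_over \<phi> \<Longrightarrow> S \<subseteq> T \<Longrightarrow> \<phi> S \<le> \<phi> T"
  by (auto simp: measure_over_def outer_measure_space_def increasing_def)

text \<open>\<open>outer_measure_space\<close> grants countable subadditivity for disjoint families
  only; disjointing the family and using monotonicity removes that restriction.\<close>

lemma measure_over_subadditive:
  assumes "measure_over \<phi>"
  shows "\<phi> (\<Union>i. E i) \<le> (\<Sum>i::nat. \<phi> (E i))"
proof -
  have "\<phi> (\<Union>i. E i) = \<phi> (\<Union>i. disjointed E i)"
    by (simp add: UN_disjointed_eq)
  also have "\<dots> \<le> (\<Sum>i. \<phi> (disjointed E i))"
    using assms disjoint_family_disjointed[of E]
    by (auto simp: measure_over_def outer_measure_space_def countably_subadditive_def)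
  also have "\<dots> \<le> (\<Sum>i. \<phi> (E i))"
    by (intro suminf_le measure_over_mono[OF assms] disjointed_subset) auto
  finally show ?thesis .
qed

lemma measure_over_Un:
  assumes "measure_over \<phi>"
  shows "\<phi> (S \<union> T) \<le> \<phi> S + \<phi> T"
proof -
  let ?E = "\<lambda>i::nat. if i = 0 then S else if i = 1 then T else {}"
  have "\<phi> (S \<union> T) \<le> \<phi> (\<Union>i. ?E i)"
    by (rule measure_over_mono[OF assms]) (force split: if_splits)
  also have "\<dots> \<le> (\<Sum>i. \<phi> (?E i))"
    by (rule measure_over_subadditive[OF assms])
  also have "\<dots> = (\<Sum>i<2. \<phi> (?E i))"
    by (rule suminf_finite) (auto simp: measure_over_empty[OF assms])
  also have "\<dots> = \<phi> S + \<phi> T" by (simp add: numeral_2_eq_2)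
  finally show ?thesis .
qed

lemma measure_over_countable_null:
  assumes "measure_over \<phi>" and "countable \<U>" and "E \<subseteq> \<Union>\<U>"
    and "\<And>U. U \<in> \<U> \<Longrightarrow> \<phi> (U \<inter> E) = 0"
  shows "\<phi> E = 0"
proof (cases "\<U> = {}")
  case True
  then show ?thesis using assms(1,3) measure_over_empty by auto
next
  case False
  have "\<phi> E \<le> \<phi> (\<Union>i. from_nat_into \<U> i \<inter> E)"
    using assms(3) range_from_nat_into[OF False assms(2)]
    by (intro measure_over_mono[OF assms(1)]) blast
  also have "\<dots> \<le> (\<Sum>i. \<phi> (from_nat_into \<U> i \<inter> E))"
    by (rule measure_over_subadditive[OF assms(1)])
  also have "\<dots> = 0"
    using assms(4) from_nat_into[OF False] by simp
  finally show ?thesis by simp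
qed

lemma carath_setsI:
  assumes "measure_over \<phi>" and "\<And>T. \<phi> (T \<inter> S) + \<phi> (T - S) \<le> \<phi> T"
  shows "S \<in> carath_sets \<phi>"
proof -
  have "\<phi> (S \<inter> T) + \<phi> ((UNIV - S) \<inter> T) = \<phi> T" for T
  proof (rule antisym)
    have "(UNIV - S) \<inter> T = T - S" by auto
    then show "\<phi> (S \<inter> T) + \<phi> ((UNIV - S) \<inter> T) \<le> \<phi> T"
      using assms(2)[of T] by (simp add: Int_commute)
    have "\<phi> T = \<phi> ((S \<inter> T) \<union> ((UNIV - S) \<inter> T))"
      by (rule arg_cong[of _ _ \<phi>]) auto
    also have "\<dots> \<le> \<phi> (S \<inter> T) + \<phi> ((UNIV - S) \<inter> T)"
      by (rule measure_over_Un[OF assms(1)])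
    finally show "\<phi> T \<le> \<phi> (S \<inter> T) + \<phi> ((UNIV - S) \<inter> T)" .
  qed
  then show ?thesis by (simp add: carath_sets_def lambda_system_def)
qed

lemma space_carath_measure [simp]: "space (carath_measure \<phi>) = UNIV"
  by (simp add: carath_measure_def space_measure_of_conv)

lemma sets_carath_measureI:
  "measure_over \<phi> \<Longrightarrow> Borel_measure \<phi> \<Longrightarrow> E \<in> sets borel \<Longrightarrow> E \<in> sets (carath_measure \<phi>)"
  by (auto simp: sets_carath_measure Borel_measure_def)

lemma emeasure_carath_borel:
  "measure_over \<phi> \<Longrightarrow> Borel_measure \<phi> \<Longrightarrow> E \<in> sets borel \<Longrightarrow>
    emeasure (carath_measure \<phi>) E = \<phi> E"
  by (auto simp: emeasure_carath_measure Borel_measure_def)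

text \<open>Continuity from below for sets that need not be measurable. Each \<open>E n\<close> gets
  a measurable hull \<open>H n\<close> of the same measure. The hulls need not increase, but the
  tail intersections \<open>D n\<close> do, still contain \<open>E n\<close>, and are no larger than
  \<open>H n\<close>.\<close>

lemma regular_measure_incseq_le:
  assumes \<phi>: "measure_over \<phi>" and "regular_measure \<phi>" and inc: "incseq E"
    and le: "\<And>n. \<phi> (E n) \<le> C"
  shows "\<phi> (\<Union>n::nat. E n) \<le> C"
proof -
  let ?M = "carath_measure \<phi>"
  have "\<forall>n. \<exists>H. H \<in> carath_sets \<phi> \<and> E n \<subseteq> H \<and> \<phi> H = \<phi> (E n)"
    using assms(2) unfolding regular_measure_def by blast
  then obtain H where H: "\<And>n. H n \<in> carath_sets \<phi>" "\<And>n. E n \<subseteq> H n" "\<And>n. \<phi> (H n) = \<phi> (E n)"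
    by (auto dest!: choice)
  define D where "D n = (\<Inter>k\<in>{n..}. H k)" for n
  have sets: "H n \<in> sets ?M" for n using H(1) by (simp add: sets_carath_measure[OF \<phi>])
  have D: "D n \<in> sets ?M" for n
    unfolding D_def using sets sets.top[of ?M] by (intro sets.countable_INT'') auto
  have incD: "incseq D"
    unfolding D_def incseq_def by auto
  have ED: "E n \<subseteq> D n" for n
    unfolding D_def using H(2) inc by (force simp: incseq_def)
  have leD: "emeasure ?M (D n) \<le> C" for n
  proof -
    have "emeasure ?M (D n) \<le> emeasure ?M (H n)"
      by (intro emeasure_mono sets) (auto simp: D_def)
    then show ?thesis using le[of n] by (simp add: emeasure_carath_measure[OF \<phi> H(1)] H(3))
  qed
  have U: "(\<Union>n. D n) \<in> carath_sets \<phi>"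
    using D by (simp flip: sets_carath_measure[OF \<phi>])
  have "\<phi> (\<Union>n. E n) \<le> \<phi> (\<Union>n. D n)"
    using ED by (intro measure_over_mono[OF \<phi>]) blast
  also have "\<dots> = emeasure ?M (\<Union>n. D n)"
    by (rule emeasure_carath_measure[OF \<phi> U, symmetric])
  also have "\<dots> = (SUP n. emeasure ?M (D n))"
    using D incD by (intro SUP_emeasure_incseq[symmetric]) auto
  also have "\<dots> \<le> C" by (intro SUP_least leD)
  finally show ?thesis .
qed

text \<open>It suffices to split \<open>T\<close> along a closed \<open>F\<close>. The points of
  \<open>T\<close> at distance at least \<open>1/(n+1)\<close> from \<open>F\<close> are separated
  from \<open>T \<inter> F\<close>, so additivity applies to them. The rest of \<open>T - F\<close>
  lies in shells around \<open>F\<close> whose measures have a finite sum, so its contribution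
  vanishes as \<open>n\<close> grows.\<close>

lemma caratheodory_criterion:
  fixes \<phi> :: "'a::metric_space set \<Rightarrow> ennreal"
  assumes \<phi>: "measure_over \<phi>"
    and add: "\<And>P Q d. 0 < d \<Longrightarrow> (\<And>x y. x \<in> P \<Longrightarrow> y \<in> Q \<Longrightarrow> d \<le> dist x y) \<Longrightarrow>
      \<phi> P + \<phi> Q \<le> \<phi> (P \<union> Q)"
  shows "Borel_measure \<phi>"
proof -
  have closed: "F \<in> carath_sets \<phi>" if "closed F" for F
  proof (rule carath_setsI[OF \<phi>])
    fix T
    show "\<phi> (T \<inter> F) + \<phi> (T - F) \<le> \<phi> T"
    \<comment> \<open>For empty \<open>F\<close> the value of \<open>infdist\<close> is 0 by
      convention, so the shells below would carry no information.\<close>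
    proof (cases "\<phi> T = \<infinity> \<or> F = {}")
      case True
      then show ?thesis by (auto simp: measure_over_empty[OF \<phi>])
    next
      case False
      then have fin: "\<phi> T < \<infinity>" and ne: "F \<noteq> {}" by (auto simp: top.not_eq_extremum)
      define R where "R k = {x\<in>T. 1 / real (k+2) \<le> infdist x F \<and> infdist x F < 1 / real (k+1)}" for k
      define L where "L n = {x\<in>T. 1 / real (n+1) \<le> infdist x F}" for n
      have sep: "infdist x F - infdist y F \<le> dist x y" for x y
        using infdist_triangle[of x F y] by simp
      \<comment> \<open>Shells whose indices have the same parity are at positive distance from each other.\<close>
      have half: "(\<Sum>k. \<phi> (R (2*k+p))) \<le> \<phi> T" for p
      proof -
        have "(\<Sum>k<N. \<phi> (R (2*k+p))) \<le> \<phi> (\<Union>k<N. R (2*k+p))" for N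
        proof (induction N)
          case (Suc N)
          have "(\<Sum>k<Suc N. \<phi> (R (2*k+p))) \<le> \<phi> (\<Union>k<N. R (2*k+p)) + \<phi> (R (2*N+p))"
            using Suc by (simp add: add_right_mono)
          also have "\<dots> \<le> \<phi> ((\<Union>k<N. R (2*k+p)) \<union> R (2*N+p))"
          \<comment> \<open>For \<open>N = 0\<close> the left union is empty; the gap used otherwise
            would contain \<open>1 / 0\<close> if \<open>p = 0\<close> as well.\<close>
          proof (cases "N = 0")
            case False
            show ?thesis
            proof (rule add)
              show "0 < 1 / real (2*N+p) - 1 / real (2*N+p+1)"
                using False by (auto intro!: divide_strict_left_mono)
              fix x y assume x: "x \<in> (\<Union>k<N. R (2*k+p))" and y: "y \<in> R (2*N+p)"
              from x obtain k where k: "k < N" "x \<in> R (2*k+p)" by auto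
              have "1 / real (2*N+p) \<le> 1 / real (2*k+p+2)"
                using k(1) by (intro divide_left_mono) auto
              also have "\<dots> \<le> infdist x F" using k(2) by (simp add: R_def add_ac)
              finally show "1 / real (2*N+p) - 1 / real (2*N+p+1) \<le> dist x y"
                using y sep[of x y] by (simp add: R_def)
            qed
          qed (simp add: measure_over_empty[OF \<phi>])
          also have "\<dots> = \<phi> (\<Union>k<Suc N. R (2*k+p))"
            by (simp add: lessThan_Suc Un_commute)
          finally show ?case .
        qed simp
        also have "\<phi> (\<Union>k<N. R (2*k+p)) \<le> \<phi> T" for N
          by (intro measure_over_mono[OF \<phi>]) (auto simp: R_def)
        finally show ?thesis by (intro suminf_le_const) auto
      qed
      have "(\<Sum>k<N. \<phi> (R k)) \<le> \<phi> T + \<phi> T" for N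
      proof -
        have "(\<Sum>k<N. \<phi> (R k)) \<le> (\<Sum>k<2*N. \<phi> (R k))"
          by (intro sum_mono2) auto
        also have "\<dots> = (\<Sum>k<N. \<phi> (R (2*k+0))) + (\<Sum>k<N. \<phi> (R (2*k+1)))"
          by (induction N) (auto simp: add_ac)
        also have "\<dots> \<le> (\<Sum>k. \<phi> (R (2*k+0))) + (\<Sum>k. \<phi> (R (2*k+1)))"
          by (intro add_mono sum_le_suminf) auto
        also have "\<dots> \<le> \<phi> T + \<phi> T" by (intro add_mono half)
        finally show ?thesis .
      qed
      then have "(\<Sum>k. \<phi> (R k)) \<le> \<phi> T + \<phi> T" by (intro suminf_le_const) auto
      then have finR: "(\<Sum>k. \<phi> (R k)) < \<infinity>"
        using fin by (simp add: le_less_trans)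
      show ?thesis
      proof (rule ennreal_le_epsilon)
        fix e :: real assume "0 < e"
        then obtain n where n: "(\<Sum>k. \<phi> (R (k + n))) < ennreal e"
          using ennreal_suminf_tail_less[OF finR, of "ennreal e"] by auto
        have "T - F \<subseteq> L n \<union> (\<Union>k. R (k + n))"
        proof
          fix x assume x: "x \<in> T - F"
          then have pos: "0 < infdist x F"
            using \<open>closed F\<close> ne infdist_pos_not_in_closed by blast
          show "x \<in> L n \<union> (\<Union>k. R (k + n))"
          proof (cases "x \<in> L n")
            case False
            then have ub: "infdist x F < 1 / real (n+1)" using x by (simp add: L_def)
            obtain m where m: "1 / real (m+1) \<le> infdist x F"
              using nat_approx_posE[OF pos] by (metis Suc_eq_plus1 less_imp_le)
            \<comment> \<open>Minimality gives \<open>infdist x F < 1 / j\<close>, and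
              \<open>x \<notin> L n\<close> forces \<open>j > n\<close>; hence \<open>x\<close> lies
              in the shell with index \<open>j - 1\<close>, which is at least
              \<open>n\<close>.\<close>
            define j where "j = (LEAST j. 1 / real (j+1) \<le> infdist x F)"
            have j: "1 / real (j+1) \<le> infdist x F"
              unfolding j_def using m by (rule LeastI)
            have "\<not> j \<le> n"
            proof
              assume "j \<le> n"
              then have "1 / real (n+1) \<le> 1 / real (j+1)" by (intro divide_left_mono) auto
              with j ub show False by simp
            qed
            then obtain i where i: "j = Suc (i + n)"
              by (metis add.commute less_imp_Suc_add not_le_imp_less)
            have "\<not> 1 / real (i+n+1) \<le> infdist x F"
              using not_less_Least[of "i + n" "\<lambda>j. 1 / real (j+1) \<le> infdist x F"] i
              unfolding j_def[symmetric] by auto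
            then have "x \<in> R (i + n)" using j x unfolding R_def i by (simp add: add_ac)
            then show ?thesis by auto
          qed simp
        qed
        then have "\<phi> (T - F) \<le> \<phi> (L n \<union> (\<Union>k. R (k + n)))"
          by (rule measure_over_mono[OF \<phi>])
        also have "\<dots> \<le> \<phi> (L n) + (\<Sum>k. \<phi> (R (k + n)))"
          using measure_over_Un[OF \<phi>] measure_over_subadditive[OF \<phi>]
          by (meson add_left_mono order_trans)
        finally have "\<phi> (T \<inter> F) + \<phi> (T - F) \<le> \<phi> (T \<inter> F) + \<phi> (L n) + (\<Sum>k. \<phi> (R (k + n)))"
          by (simp add: add_left_mono add.assoc)
        also have "\<phi> (T \<inter> F) + \<phi> (L n) \<le> \<phi> ((T \<inter> F) \<union> L n)"
        proof (rule add)
          fix x y assume "x \<in> T \<inter> F" "y \<in> L n"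
          then show "1 / real (n+1) \<le> dist x y"
            using infdist_le[of x F y] by (simp add: L_def dist_commute)
        qed simp
        also have "\<dots> \<le> \<phi> T" by (rule measure_over_mono[OF \<phi>]) (auto simp: L_def)
        finally show "\<phi> (T \<inter> F) + \<phi> (T - F) \<le> \<phi> T + ennreal e"
          using n by (meson add_left_mono add_right_mono less_imp_le order_trans)
      qed
    qed
  qed
  have "sets borel = sigma_sets UNIV (Collect closed :: 'a set set)"
    unfolding borel_eq_closed by simp
  also have "\<dots> \<subseteq> sets (carath_measure \<phi>)"
    using closed sets.sigma_sets_subset[of "Collect closed" "carath_measure \<phi>"]
    by (auto simp: sets_carath_measure[OF \<phi>])
  finally show ?thesis by (simp add: Borel_measure_def sets_carath_measure[OF \<phi>])
qed

section \<open>Closed balls and the spherical measure\<close>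

lemma bounded_closed_balls: "S \<in> closed_balls \<Longrightarrow> bounded S"
  by (auto simp: closed_balls_def)

lemma diameter_leI:
  assumes "S \<noteq> {}" and "\<And>x y. x \<in> S \<Longrightarrow> y \<in> S \<Longrightarrow> dist x y \<le> d"
  shows "diameter S \<le> d"
  unfolding diameter_def using assms by (auto intro!: cSUP_least)

lemma diameter_cball_le: "0 \<le> r \<Longrightarrow> diameter (cball (x::'a::metric_space) r) \<le> 2 * r"
proof (rule diameter_leI)
  fix y z assume "y \<in> cball x r" "z \<in> cball x r"
  then show "dist y z \<le> 2 * r" using dist_triangle3[of y z x] by simp
qed auto

text \<open>The radius of a closed ball need not be comparable to its diameter, but it can be chosen so.\<close>

lemma closed_balls_radius:
  fixes S :: "'a::metric_space set"
  assumes "S \<in> closed_balls" and "0 < diameter S"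
  obtains y r where "S = cball y r" "0 < r" "r \<le> diameter S" "diameter S \<le> 2 * r"
proof -
  obtain y r where S: "S = cball y r" and r: "0 < r"
    using assms(1) by (auto simp: closed_balls_def)
  let ?d = "diameter S"
  have "dist y z \<le> ?d" if "z \<in> S" for z
    using that r unfolding S by (intro diameter_bounded_bound) auto
  \<comment> \<open>The centre belongs to the ball, so every point is within the diameter of it, and
    cutting the radius down to the diameter loses nothing.\<close>
  then have "S = cball y (min r ?d)"
    unfolding S by auto
  moreover have "?d \<le> 2 * min r ?d"
    using diameter_cball_le[of r y] r assms(2) unfolding S by (auto simp: min_def)
  ultimately show ?thesis
    using that[of y "min r ?d"] r assms(2) by auto
qed

lemma diameter_eq_0_singleton:
  assumes "bounded S" "diameter S = 0" "x \<in> S"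
  shows "S = {x}"
proof -
  have "y = x" if "y \<in> S" for y
    using diameter_bounded_bound[OF assms(1,3) that] assms(2) by simp
  then show ?thesis using assms(3) by blast
qed

lemma zeta_b_empty [simp]: "zeta_b c \<alpha> {} = 0"
  by (simp add: zeta_b_def)

lemma zeta_b_less_top [simp]: "zeta_b c \<alpha> S < top"
  by (simp add: zeta_b_def)

lemma zeta_b_eq_0_iff:
  assumes "0 < c"
  shows "zeta_b c \<alpha> S = 0 \<longleftrightarrow> diameter S = 0"
  using assms(1) by (simp add: zeta_b_def ennreal_eq_zero_iff)

lemma zeta_b_le_scaled:
  assumes "0 < c" "0 < \<alpha>" "0 \<le> k" "bounded S" "bounded T" "diameter S \<le> k * diameter T"
  shows "zeta_b c \<alpha> S \<le> ennreal (k powr \<alpha>) * zeta_b c \<alpha> T"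
proof -
  have "c * diameter S powr \<alpha> \<le> c * (k * diameter T) powr \<alpha>"
    using assms diameter_ge_0 by (intro mult_left_mono powr_mono2) auto
  also have "\<dots> = k powr \<alpha> * (c * diameter T powr \<alpha>)"
    using assms diameter_ge_0 by (simp add: powr_mult)
  finally show ?thesis
    using assms by (simp add: zeta_b_def flip: ennreal_mult)
qed

text \<open>With the next lemma this trades covers with an index set for sequences over all
  naturals. The padding value is \<open>{}\<close>, which costs 0; it is not a closed ball of
  positive radius, hence the exemption in the hypothesis.\<close>

lemma spherical_premeasure_le:
  assumes "\<And>j::nat. E j \<noteq> {} \<Longrightarrow> E j \<in> closed_balls \<and> diameter (E j) \<le> \<delta>"
    and "R \<subseteq> (\<Union>j. E j)"
  shows "spherical_premeasure c \<alpha> \<delta> R \<le> (\<Sum>j. zeta_b c \<alpha> (E j))"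
proof -
  let ?J = "{j. E j \<noteq> {}}"
  have "spherical_premeasure c \<alpha> \<delta> R \<le> (\<Sum>\<^sub>\<infinity>j\<in>?J. zeta_b c \<alpha> (E j))"
    unfolding spherical_premeasure_def
    by (rule Inf_lower, rule CollectI, intro exI[of _ ?J] exI[of _ E]) (use assms in blast)
  also have "\<dots> = (\<Sum>j. zeta_b c \<alpha> (E j))"
    unfolding infsum_ennreal_eq_suminf by (rule suminf_cong) auto
  finally show ?thesis .
qed

lemma spherical_premeasure_lessE:
  assumes "spherical_premeasure c \<alpha> \<delta> R < v"
  obtains E where "\<And>j::nat. E j \<noteq> {} \<Longrightarrow> E j \<in> closed_balls \<and> diameter (E j) \<le> \<delta>"
    and "R \<subseteq> (\<Union>j. E j)" and "(\<Sum>j. zeta_b c \<alpha> (E j)) < v"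
proof -
  obtain J E where E: "\<forall>j\<in>J. E j \<in> closed_balls \<and> diameter (E j) \<le> \<delta>"
      "R \<subseteq> (\<Union>j\<in>J. E j)" "(\<Sum>\<^sub>\<infinity>j\<in>J. zeta_b c \<alpha> (E j)) < v" and "J \<subseteq> (UNIV::nat set)"
    using assms unfolding spherical_premeasure_def Inf_less_iff by auto
  let ?E = "\<lambda>j. if j \<in> J then E j else {}"
  have "(\<Sum>j. zeta_b c \<alpha> (?E j)) = (\<Sum>\<^sub>\<infinity>j\<in>J. zeta_b c \<alpha> (E j))"
    unfolding infsum_ennreal_eq_suminf by (rule suminf_cong) auto
  moreover have "R \<subseteq> (\<Union>j. ?E j)" using E(2) by fastforce
  ultimately show ?thesis
    using that[of ?E] E(1,3) by (auto split: if_splits)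
qed

lemma spherical_premeasure_mono:
  assumes "R \<subseteq> R'" "\<delta>' \<le> \<delta>"
  shows "spherical_premeasure c \<alpha> \<delta> R \<le> spherical_premeasure c \<alpha> \<delta>' R'"
proof (rule ccontr)
  assume "\<not> ?thesis"
  then have "spherical_premeasure c \<alpha> \<delta>' R' < spherical_premeasure c \<alpha> \<delta> R" by simp
  then obtain E where E: "\<And>j::nat. E j \<noteq> {} \<Longrightarrow> E j \<in> closed_balls \<and> diameter (E j) \<le> \<delta>'"
      and "R' \<subseteq> (\<Union>j. E j)" and less: "(\<Sum>j. zeta_b c \<alpha> (E j)) < spherical_premeasure c \<alpha> \<delta> R"
    by (erule spherical_premeasure_lessE)
  have "spherical_premeasure c \<alpha> \<delta> R \<le> (\<Sum>j. zeta_b c \<alpha> (E j))"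
  proof (rule spherical_premeasure_le)
    show "E j \<in> closed_balls \<and> diameter (E j) \<le> \<delta>" if "E j \<noteq> {}" for j
      using E[OF that] assms(2) by simp
    show "R \<subseteq> (\<Union>j. E j)" using \<open>R' \<subseteq> _\<close> assms(1) by simp
  qed
  with less show False by simp
qed

lemma spherical_premeasure_le_measure:
  "0 < \<delta> \<Longrightarrow> spherical_premeasure c \<alpha> \<delta> R \<le> spherical_measure c \<alpha> R"
  unfolding spherical_measure_def by (rule SUP_upper) simp

lemma spherical_premeasure_empty [simp]: "spherical_premeasure c \<alpha> \<delta> {} = 0"
  using spherical_premeasure_le[of "\<lambda>_. {}" \<delta> "{}" c \<alpha>] by simp

lemma spherical_premeasure_subadditive:
  "spherical_premeasure c \<alpha> \<delta> (\<Union>i. R i) \<le> (\<Sum>i::nat. spherical_premeasure c \<alpha> \<delta> (R i))"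
proof (rule ennreal_le_epsilon)
  let ?p = "spherical_premeasure c \<alpha> \<delta>"
  fix e :: real assume fin: "(\<Sum>i. ?p (R i)) < top" and e: "0 < e"
  \<comment> \<open>A positive error for each \<open>R i\<close>, with errors adding up to
    \<open>e\<close>.\<close>
  define h where "h i = ennreal (e * (1/2) ^ Suc i)" for i
  have "?p (R i) < ?p (R i) + h i" for i
  proof -
    have "(\<Sum>j<Suc i. ?p (R j)) \<le> (\<Sum>i. ?p (R i))" by (intro sum_le_suminf) auto
    then have "?p (R i) < top" using fin by (auto dest!: le_less_trans)
    then show ?thesis using e
      by (cases "?p (R i)") (auto simp: h_def simp flip: ennreal_plus intro!: ennreal_lessI add_nonneg_pos)
  qed
  then have "\<exists>E. (\<forall>j::nat. E j \<noteq> {} \<longrightarrow> E j \<in> closed_balls \<and> diameter (E j) \<le> \<delta>) \<and>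
      R i \<subseteq> (\<Union>j. E j) \<and> (\<Sum>j. zeta_b c \<alpha> (E j)) \<le> ?p (R i) + h i" for i
    by (metis spherical_premeasure_lessE less_imp_le)
  then have "\<exists>E. \<forall>i. (\<forall>j::nat. E i j \<noteq> {} \<longrightarrow> E i j \<in> closed_balls \<and> diameter (E i j) \<le> \<delta>) \<and>
      R i \<subseteq> (\<Union>j. E i j) \<and> (\<Sum>j. zeta_b c \<alpha> (E i j)) \<le> ?p (R i) + h i"
    by (intro choice allI)
  then obtain E where E0: "\<forall>i. (\<forall>j::nat. E i j \<noteq> {} \<longrightarrow> E i j \<in> closed_balls \<and> diameter (E i j) \<le> \<delta>) \<and>
      R i \<subseteq> (\<Union>j. E i j) \<and> (\<Sum>j. zeta_b c \<alpha> (E i j)) \<le> ?p (R i) + h i"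
    by (elim exE)
  then have E: "\<And>i j::nat. E i j \<noteq> {} \<Longrightarrow> E i j \<in> closed_balls \<and> diameter (E i j) \<le> \<delta>"
      "\<And>i. R i \<subseteq> (\<Union>j. E i j)" "\<And>i. (\<Sum>j. zeta_b c \<alpha> (E i j)) \<le> ?p (R i) + h i"
    by blast+
  let ?F = "\<lambda>k. case_prod E (prod_decode k)"
  have "?p (\<Union>i. R i) \<le> (\<Sum>k. zeta_b c \<alpha> (?F k))"
  proof (rule spherical_premeasure_le)
    show "(\<Union>i. R i) \<subseteq> (\<Union>k. ?F k)"
    proof safe
      fix x i assume "x \<in> R i"
      then obtain j where "x \<in> E i j" using E(2)[of i] by auto
      then have "x \<in> ?F (prod_encode (i, j))" by simp
      then show "x \<in> (\<Union>k. ?F k)" by (rule UN_I[OF UNIV_I])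
    qed
    show "?F k \<in> closed_balls \<and> diameter (?F k) \<le> \<delta>" if "?F k \<noteq> {}" for k
      using E(1)[of "fst (prod_decode k)" "snd (prod_decode k)"] that by (simp add: case_prod_beta)
  qed
  also have "\<dots> = (\<Sum>i. \<Sum>j. zeta_b c \<alpha> (E i j))"
    using suminf_ennreal_2dimen[of "\<lambda>i. \<Sum>j. zeta_b c \<alpha> (E i j)" "\<lambda>(i, j). zeta_b c \<alpha> (E i j)"]
    by (simp add: case_prod_beta)
  also have "\<dots> \<le> (\<Sum>i. ?p (R i) + h i)" by (intro suminf_le E) auto
  also have "\<dots> = (\<Sum>i. ?p (R i)) + (\<Sum>i. h i)" by (intro suminf_add[symmetric]) auto
  also have "(\<Sum>i. h i) = ennreal e"
    unfolding h_def
    using e sums_mult[OF power_half_series, of e] by (intro suminf_ennreal_eq) auto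
  finally show "?p (\<Union>i. R i) \<le> (\<Sum>i. ?p (R i)) + ennreal e" .
qed

lemma measure_over_spherical: "measure_over (spherical_measure c \<alpha>)"
proof -
  have "spherical_measure c \<alpha> (\<Union>i. R i) \<le> (\<Sum>i. spherical_measure c \<alpha> (R i))" for R :: "nat \<Rightarrow> 'a set"
    unfolding spherical_measure_def[of c \<alpha> "\<Union>i. R i"]
  proof (rule SUP_least)
    fix \<delta> :: real assume "\<delta> \<in> {0<..}"
    then have "(\<Sum>i. spherical_premeasure c \<alpha> \<delta> (R i)) \<le> (\<Sum>i. spherical_measure c \<alpha> (R i))"
      by (intro suminf_le spherical_premeasure_le_measure) auto
    then show "spherical_premeasure c \<alpha> \<delta> (\<Union>i. R i) \<le> (\<Sum>i. spherical_measure c \<alpha> (R i))"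
      using spherical_premeasure_subadditive order_trans by blast
  qed
  moreover have "spherical_measure c \<alpha> R \<le> spherical_measure c \<alpha> R'" if "R \<subseteq> R'" for R R' :: "'a set"
    unfolding spherical_measure_def using that by (intro SUP_mono' spherical_premeasure_mono) auto
  ultimately show ?thesis
    by (auto simp: measure_over_def outer_measure_space_def positive_def increasing_def
        countably_subadditive_def spherical_measure_def[of _ _ "{}"])
qed

text \<open>A set of diameter at most \<delta> cannot meet both \<open>P\<close> and
  \<open>Q\<close>, so any cover of the union splits into two covers that share no nonempty
  member.\<close>

lemma spherical_premeasure_separated:
  assumes "\<And>x y. x \<in> P \<Longrightarrow> y \<in> Q \<Longrightarrow> d \<le> dist x y" and "\<delta> < d"
  shows "spherical_premeasure c \<alpha> \<delta> P + spherical_premeasure c \<alpha> \<delta> Q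
    \<le> spherical_premeasure c \<alpha> \<delta> (P \<union> Q)"
proof (rule ccontr)
  let ?p = "spherical_premeasure c \<alpha> \<delta>"
  assume "\<not> ?thesis"
  then have "?p (P \<union> Q) < ?p P + ?p Q" by simp
  then obtain E where E: "\<And>j::nat. E j \<noteq> {} \<Longrightarrow> E j \<in> closed_balls \<and> diameter (E j) \<le> \<delta>"
      "P \<union> Q \<subseteq> (\<Union>j. E j)" "(\<Sum>j. zeta_b c \<alpha> (E j)) < ?p P + ?p Q"
    by (erule spherical_premeasure_lessE)
  let ?EP = "\<lambda>j. if E j \<inter> P = {} then {} else E j"
  let ?EQ = "\<lambda>j. if E j \<inter> Q = {} then {} else E j"
  have disj: "E j \<inter> P = {} \<or> E j \<inter> Q = {}" for j
  proof (rule ccontr)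
    assume "\<not> ?thesis"
    then obtain x y where xy: "x \<in> E j" "x \<in> P" "y \<in> E j" "y \<in> Q" by auto
    then have "dist x y \<le> \<delta>"
      using E(1)[of j] diameter_bounded_bound[OF bounded_closed_balls, of "E j" x y] by fastforce
    with assms(1)[OF xy(2,4)] assms(2) show False by simp
  qed
  have "?p P \<le> (\<Sum>j. zeta_b c \<alpha> (?EP j))" "?p Q \<le> (\<Sum>j. zeta_b c \<alpha> (?EQ j))"
    using E(1,2) by (intro spherical_premeasure_le; force split: if_splits)+
  then have "?p P + ?p Q \<le> (\<Sum>j. zeta_b c \<alpha> (?EP j)) + (\<Sum>j. zeta_b c \<alpha> (?EQ j))"
    by (rule add_mono)
  also have "\<dots> = (\<Sum>j. zeta_b c \<alpha> (?EP j) + zeta_b c \<alpha> (?EQ j))"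
    by (intro suminf_add) auto
  also have "\<dots> \<le> (\<Sum>j. zeta_b c \<alpha> (E j))"
    using disj by (intro suminf_le) auto
  finally show False using E(3) by simp
qed

lemma Borel_measure_spherical: "Borel_measure (spherical_measure c \<alpha>)"
proof (rule caratheodory_criterion[OF measure_over_spherical])
  fix P Q :: "'a set" and d :: real
  assume d: "0 < d" and sep: "\<And>x y. x \<in> P \<Longrightarrow> y \<in> Q \<Longrightarrow> d \<le> dist x y"
  let ?p = "spherical_premeasure c \<alpha>" and ?m = "spherical_measure c \<alpha>"
  \<comment> \<open>The two scales are independent so that the suprema over them can be taken one
    after the other.\<close>
  have le: "?p \<delta> P + ?p \<epsilon> Q \<le> ?m (P \<union> Q)" if "0 < \<delta>" "0 < \<epsilon>" for \<delta> \<epsilon>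
  proof -
    define \<eta> where "\<eta> = Min {\<delta>, \<epsilon>, d / 2}"
    have \<eta>: "0 < \<eta>" "\<eta> \<le> \<delta>" "\<eta> \<le> \<epsilon>" "\<eta> < d" using that d by (auto simp: \<eta>_def min_def)
    have "?p \<delta> P + ?p \<epsilon> Q \<le> ?p \<eta> P + ?p \<eta> Q"
      using \<eta> by (intro add_mono spherical_premeasure_mono) auto
    also have "\<dots> \<le> ?p \<eta> (P \<union> Q)"
      using sep \<eta>(4) by (rule spherical_premeasure_separated)
    also have "\<dots> \<le> ?m (P \<union> Q)" using \<eta>(1) by (rule spherical_premeasure_le_measure)
    finally show ?thesis .
  qed
  have "?p \<delta> P + ?m Q \<le> ?m (P \<union> Q)" if "0 < \<delta>" for \<delta>
    unfolding spherical_measure_def[of c \<alpha> Q]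
    using le[OF that] by (subst ennreal_SUP_add_right) (auto intro!: SUP_least)
  then show "?m P + ?m Q \<le> ?m (P \<union> Q)"
    unfolding spherical_measure_def[of c \<alpha> P]
    by (subst ennreal_SUP_add_left[symmetric]) (auto intro!: SUP_least)
qed

section \<open>Measurability of the Federer density\<close>

text \<open>The Federer density before the infimum over scales is taken. Topological arguments apply
  at a fixed scale; the density itself is then a countable infimum of such functions.\<close>

definition density_below ::
  "real \<Rightarrow> real \<Rightarrow> ('a::metric_space set \<Rightarrow> ennreal) \<Rightarrow> real \<Rightarrow> 'a \<Rightarrow> ennreal" where
  "density_below c \<alpha> \<mu> \<epsilon> x =
     (SUP S\<in>{S \<in> admissible_balls \<mu> (zeta_b c \<alpha>). x \<in> S \<and> diameter S < \<epsilon>}.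
        quotient_fun \<mu> (zeta_b c \<alpha>) S)"

lemma density_below_mono:
  "\<epsilon> \<le> \<epsilon>' \<Longrightarrow> density_below c \<alpha> \<mu> \<epsilon> x \<le> density_below c \<alpha> \<mu> \<epsilon>' x"
  unfolding density_below_def by (rule SUP_subset_mono) auto

lemma Federer_density_le_below:
  "0 < \<epsilon> \<Longrightarrow> Federer_density c \<alpha> \<mu> x \<le> density_below c \<alpha> \<mu> \<epsilon> x"
  unfolding Federer_density_def density_below_def by (rule INF_lower) simp

text \<open>The shift \<open>m\<close> keeps all scales at most \<open>1 / real (Suc m)\<close>, so
  that they stay within a radius bound valid on a whole piece of the space.\<close>

lemma Federer_density_eq_INF:
  "Federer_density c \<alpha> \<mu> x = (INF n. density_below c \<alpha> \<mu> (1 / real (Suc (n + m))) x)"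
proof (rule antisym)
  show "Federer_density c \<alpha> \<mu> x \<le> (INF n. density_below c \<alpha> \<mu> (1 / real (Suc (n + m))) x)"
    by (intro INF_greatest Federer_density_le_below) simp
  have "(INF n. density_below c \<alpha> \<mu> (1 / real (Suc (n + m))) x) \<le> density_below c \<alpha> \<mu> \<epsilon> x"
    if \<epsilon>: "0 < \<epsilon>" for \<epsilon>
  proof -
    obtain n where n: "1 / real (Suc n) < \<epsilon>" using nat_approx_posE[OF \<epsilon>] by blast
    have "1 / real (Suc (n + m)) \<le> 1 / real (Suc n)" by (intro divide_left_mono) auto
    then show ?thesis
      using n by (intro INF_lower2[of n] density_below_mono) auto
  qed
  then show "(INF n. density_below c \<alpha> \<mu> (1 / real (Suc (n + m))) x) \<le> Federer_density c \<alpha> \<mu> x"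
    unfolding Federer_density_def density_below_def by (intro INF_greatest) simp
qed

section \<open>Quotients and admissible balls\<close>

lemma divide_le_ennreal_iff:
  fixes a b t :: ennreal
  assumes "b \<noteq> 0" "b < top"
  shows "a / b \<le> t \<longleftrightarrow> a \<le> t * b"
proof
  assume "a / b \<le> t"
  then have "a / b * b \<le> t * b" by (rule mult_right_mono) simp
  then show "a \<le> t * b" using assms by (simp add: ennreal_divide_times)
next
  assume "a \<le> t * b"
  then have "a / b \<le> t * b / b" by (rule divide_right_mono_ennreal)
  also have "\<dots> = t" using assms by (simp flip: ennreal_times_divide)
  finally show "a / b \<le> t" .
qed

lemma less_divide_ennreal_iff:
  fixes a b t :: ennreal
  assumes "b \<noteq> 0" "b < top"
  shows "t < a / b \<longleftrightarrow> t * b < a"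
  using divide_le_ennreal_iff[OF assms, of a t] by (simp add: not_le[symmetric])

lemma quotient_fun_le_iff:
  assumes "zeta_b c \<alpha> S \<noteq> 0"
  shows "quotient_fun \<mu> (zeta_b c \<alpha>) S \<le> t \<longleftrightarrow> \<mu> S \<le> t * zeta_b c \<alpha> S"
  using assms by (simp add: quotient_fun_def divide_le_ennreal_iff)

lemma less_quotient_fun_iff:
  assumes "zeta_b c \<alpha> S \<noteq> 0"
  shows "t < quotient_fun \<mu> (zeta_b c \<alpha>) S \<longleftrightarrow> t * zeta_b c \<alpha> S < \<mu> S"
  using quotient_fun_le_iff[OF assms, of \<mu> t] by (meson not_le)

text \<open>Since \<open>zeta_b\<close> is always finite, a ball can be excluded only when
  \<open>zeta_b\<close> and \<mu> both vanish on it.\<close>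

lemma admissible_ballsI:
  "S \<in> closed_balls \<Longrightarrow> zeta_b c \<alpha> S \<noteq> 0 \<Longrightarrow> S \<in> admissible_balls \<mu> (zeta_b c \<alpha>)"
  by (auto simp: admissible_balls_def zeta_b_def)

text \<open>A ball \<open>S\<close> witnessing the inequality at \<open>x\<close> is replaced by a
  slightly larger concentric ball \<open>T\<close> that has \<open>x\<close> in its interior. Then
  \<mu> does not decrease, and continuity of the diameter keeps \<open>zeta_b\<close> almost
  unchanged, so \<open>T\<close> is a witness for each of its own points.\<close>

lemma interior_density_below:
  fixes \<mu> :: "'a::metric_space set \<Rightarrow> ennreal"
  assumes \<mu>: "measure_over \<mu>" and c: "0 < c" and \<alpha>: "0 < \<alpha>" and "\<epsilon> \<le> \<rho>"
    and cont: "\<And>y. dist x y < 2 * \<rho> \<Longrightarrow> continuous_on {0<..<\<rho>} (\<lambda>r. diameter (ball y r))"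
    and "t < density_below c \<alpha> \<mu> \<epsilon> x"
  shows "x \<in> interior {z. t < density_below c \<alpha> \<mu> \<epsilon> z}"
proof -
  obtain S where S: "S \<in> admissible_balls \<mu> (zeta_b c \<alpha>)" "x \<in> S" "diameter S < \<epsilon>"
      "t < quotient_fun \<mu> (zeta_b c \<alpha>) S"
    using assms(6) unfolding density_below_def less_SUP_iff by blast
  have ball: "S \<in> closed_balls" using S(1) by (simp add: admissible_balls_def)
  let ?d = "diameter S"
  have "0 \<le> ?d" by (intro diameter_ge_0 bounded_closed_balls ball)
  then consider "?d = 0" | "0 < ?d" by linarith
  then show ?thesis
  proof cases
    case 1
    \<comment> \<open>A ball of diameter 0 consists of \<open>x\<close> alone, so its centre is
      \<open>x\<close>. Then \<open>x\<close> is isolated, and \<open>{x}\<close> is already a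
      neighbourhood.\<close>
    then have Sx: "S = {x}"
      by (intro diameter_eq_0_singleton bounded_closed_balls ball S)
    obtain y r where yr: "S = cball y r" "0 < r" using ball by (auto simp: closed_balls_def)
    then have "y \<in> S" by simp
    then have "y = x" using Sx by blast
    then have "S = cball x r" "0 < r" using yr by simp_all
    then have "ball x r \<subseteq> {x}" using Sx ball_subset_cball by metis
    then have "ball x r \<subseteq> {z. t < density_below c \<alpha> \<mu> \<epsilon> z}" using assms(6) by blast
    with \<open>0 < r\<close> show ?thesis by (auto simp: mem_interior)
  next
    case 2
    then obtain y r where r: "S = cball y r" "0 < r" "r \<le> ?d"
      using closed_balls_radius[OF ball] by metis
    \<comment> \<open>Choosing the radius no larger than the diameter places it in the interval
      where the diameter function is continuous.\<close>
    have r\<rho>: "r < \<rho>" using r(3) S(3) assms(4) by simp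
    have zS: "zeta_b c \<alpha> S \<noteq> 0" using 2 by (simp add: zeta_b_eq_0_iff[OF c])
    have "t < top" using S(4) by (rule order.strict_trans2) simp
    then obtain u where u: "t = ennreal u" "0 \<le> u" by (cases t) auto
    \<comment> \<open>The inequality for \<open>S\<close> is strict, so it survives a small increase
      \<eta> of the diameter; \<eta> is also kept below \<open>\<epsilon> - ?d\<close> to stay at
      scale \<epsilon>.\<close>
    have "((\<lambda>\<eta>. ennreal (u * (c * (?d + \<eta>) powr \<alpha>))) \<longlongrightarrow> ennreal (u * (c * (?d + 0) powr \<alpha>))) (at_right 0)"
      using 2 by (intro tendsto_intros tendsto_ennrealI) auto
    moreover have "ennreal (u * (c * (?d + 0) powr \<alpha>)) < \<mu> S"
      using S(4) zS u c by (simp add: less_quotient_fun_iff zeta_b_def ennreal_mult)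
    ultimately have "eventually (\<lambda>\<eta>. ennreal (u * (c * (?d + \<eta>) powr \<alpha>)) < \<mu> S) (at_right 0)"
      by (rule order_tendstoD(2))
    moreover have "eventually (\<lambda>\<eta>. \<eta> < \<epsilon> - ?d) (at_right 0)"
      using S(3) by (intro eventually_at_rightI[of 0 "\<epsilon> - ?d"]) auto
    moreover have "eventually (\<lambda>\<eta>. \<eta> > 0) (at_right (0::real))"
      by (rule eventually_at_right_less)
    ultimately have "eventually (\<lambda>\<eta>. ennreal (u * (c * (?d + \<eta>) powr \<alpha>)) < \<mu> S \<and> \<eta> < \<epsilon> - ?d \<and> \<eta> > 0)
        (at_right (0::real))"
      by eventually_elim simp
    then obtain \<eta> where \<eta>: "ennreal (u * (c * (?d + \<eta>) powr \<alpha>)) < \<mu> S" "\<eta> < \<epsilon> - ?d" "\<eta> > 0"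
      by (auto dest!: eventually_happens)
    have xy: "dist y x \<le> r" using S(2) r(1) by simp
    then have "isCont (\<lambda>r. diameter (ball y r)) r"
      using cont[of y] r(2) r\<rho> by (intro continuous_on_interior[of "{0<..<\<rho>}"]) (auto simp: dist_commute)
    then have "((\<lambda>r. diameter (ball y r)) \<longlongrightarrow> diameter (ball y r)) (at_right r)"
      by (auto simp: isCont_def intro: filterlim_mono[OF _ order_refl] at_le)
    moreover have "diameter (ball y r) < ?d + \<eta>"
      using \<eta>(3) diameter_subset[of "ball y r" S] r(1) by (simp add: ball_subset_cball)
    ultimately have "eventually (\<lambda>s. diameter (ball y s) < ?d + \<eta>) (at_right r)"
      by (rule order_tendstoD(2))
    moreover have "eventually (\<lambda>s. s > r) (at_right r)" by (rule eventually_at_right_less)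
    ultimately have "eventually (\<lambda>s. diameter (ball y s) < ?d + \<eta> \<and> s > r) (at_right r)"
      by eventually_elim simp
    then obtain s where s: "diameter (ball y s) < ?d + \<eta>" "s > r"
      by (auto dest!: eventually_happens)
    \<comment> \<open>Continuity is known for open balls only. The closed ball of intermediate
      radius contains \<open>S\<close> and lies in \<open>ball y s\<close>, whose diameter is
      controlled.\<close>
    define T where "T = cball y ((r + s) / 2)"
    have T: "T \<in> closed_balls" 
      unfolding T_def closed_balls_def using s(2) r(2)
      by (intro CollectI exI[of _ y] exI[of _ "(r + s) / 2"]) simp
    have ST: "S \<subseteq> T" using s(2) by (auto simp: T_def r(1))
    have "diameter T \<le> diameter (ball y s)"
      using s(2) by (intro diameter_subset) (auto simp: T_def)
    then have dT: "diameter T < ?d + \<eta>" using s(1) by simp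
    have dST: "?d \<le> diameter T" by (rule diameter_subset[OF ST bounded_closed_balls[OF T]])
    have zT: "zeta_b c \<alpha> T \<noteq> 0" using 2 dST by (simp add: zeta_b_eq_0_iff[OF c])
    have "t * zeta_b c \<alpha> T = ennreal (u * (c * diameter T powr \<alpha>))"
      using u c by (simp add: zeta_b_def ennreal_mult)
    also have "\<dots> \<le> ennreal (u * (c * (?d + \<eta>) powr \<alpha>))"
      using u c \<alpha> dT dST 2 by (intro ennreal_leI mult_left_mono powr_mono2) auto
    also have "\<dots> < \<mu> S" by (rule \<eta>)
    also have "\<dots> \<le> \<mu> T" by (rule measure_over_mono[OF \<mu> ST])
    finally have QT: "t < quotient_fun \<mu> (zeta_b c \<alpha>) T"
      by (simp add: less_quotient_fun_iff[OF zT])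
    have "t < density_below c \<alpha> \<mu> \<epsilon> z" if "z \<in> T" for z
      unfolding density_below_def less_SUP_iff
      using QT that dT \<eta>(2) admissible_ballsI[OF T zT] by (intro bexI[of _ T]) auto
    then have "ball y ((r + s) / 2) \<subseteq> {z. t < density_below c \<alpha> \<mu> \<epsilon> z}"
      by (auto simp: T_def)
    moreover have "x \<in> ball y ((r + s) / 2)" using xy s(2) by simp
    ultimately show ?thesis by (rule interiorI[OF open_ball, rotated])
  qed
qed

lemma Federer_density_measurable:
  fixes \<mu> :: "'a::metric_space set \<Rightarrow> ennreal"
  assumes \<mu>: "measure_over \<mu>" and c: "0 < c" and \<alpha>: "0 < \<alpha>" and reg: "diametrically_regular TYPE('a)"
  shows "Federer_density c \<alpha> \<mu> \<in> borel_measurable borel"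
proof -
  let ?C = "\<lambda>m y::'a. continuous_on {0<..<1 / real (Suc m)} (\<lambda>r. diameter (ball y r))"
  \<comment> \<open>One radius bound must serve all centres of small balls that can contain the point.\<close>
  define O' where "O' m = {x. \<forall>y. dist x y < 2 * (1 / real (Suc m)) \<longrightarrow> ?C m y}" for m
  have O_borel: "O' m \<in> sets borel" for m
  proof -
    have "- O' m = (\<Union>y\<in>{y. \<not> ?C m y}. ball y (2 * (1 / real (Suc m))))"
      by (auto simp: O'_def dist_commute)
    then have "open (- O' m)" by (simp only:) (intro open_UN ballI open_ball)
    then have "closed (O' m)" by (simp add: closed_def)
    then show ?thesis by simp
  qed
  have cover: "\<exists>m. x \<in> O' m" for x
  proof -
    obtain R \<delta> where R: "R > 0" "\<delta> > 0"
        "\<And>y. y \<in> ball x R \<Longrightarrow> continuous_on {0<..<\<delta>} (\<lambda>r. diameter (ball y r))"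
      using reg unfolding diametrically_regular_def by meson
    \<comment> \<open>Half of \<open>R\<close>, because in \<open>O' m\<close> the centres range
      over a ball of radius twice \<open>1 / real (Suc m)\<close>.\<close>
    obtain m where m: "1 / real (Suc m) < min (R / 2) \<delta>"
      using nat_approx_posE[of "min (R / 2) \<delta>"] R by auto
    have "x \<in> O' m"
      unfolding O'_def using m by (auto intro!: continuous_on_subset[OF R(3)])
    then show ?thesis ..
  qed
  have meas: "density_below c \<alpha> \<mu> (1 / real (Suc (n + m))) \<in> borel_measurable (restrict_space borel (O' m))" for n m
  proof (rule borel_measurableI_greater)
    fix t
    let ?W = "{z. t < density_below c \<alpha> \<mu> (1 / real (Suc (n + m))) z}"
    \<comment> \<open>The superlevel set need not be open, but its points in \<open>O' m\<close> are
      interior points, which makes it relatively open there.\<close>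
    have "O' m \<inter> ?W = O' m \<inter> interior ?W"
    proof (rule set_eqI)
      fix x
      have "x \<in> interior ?W" if "x \<in> O' m" "x \<in> ?W"
        using that by (intro interior_density_below[OF \<mu> c \<alpha>, where \<rho> = "1 / real (Suc m)"])
          (auto simp: O'_def intro!: divide_left_mono)
      then show "x \<in> O' m \<inter> ?W \<longleftrightarrow> x \<in> O' m \<inter> interior ?W"
        using interior_subset[of ?W] by blast
    qed
    moreover have "{x \<in> space (restrict_space borel (O' m)). t < density_below c \<alpha> \<mu> (1 / real (Suc (n + m))) x} = O' m \<inter> ?W"
      by (auto simp: space_restrict_space)
    ultimately show "{x \<in> space (restrict_space borel (O' m)). t < density_below c \<alpha> \<mu> (1 / real (Suc (n + m))) x}
        \<in> sets (restrict_space borel (O' m))"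
      using O_borel[of m] by (auto simp: sets_restrict_space_iff)
  qed
  have restr: "Federer_density c \<alpha> \<mu> \<in> borel_measurable (restrict_space borel (O' m))" for m
  proof -
    have "Federer_density c \<alpha> \<mu> = (\<lambda>x. INF n. density_below c \<alpha> \<mu> (1 / real (Suc (n + m))) x)"
      by (rule ext) (rule Federer_density_eq_INF)
    then show ?thesis using meas by (simp add: borel_measurable_INF)
  qed
  show ?thesis
  proof (rule measurable_piecewise_restrict[of "range O'"])
    show "space borel \<subseteq> \<Union> (range O')" using cover by blast
  qed (use O_borel restr in auto)
qed

section \<open>The upper estimate\<close>

text \<open>On \<open>F n\<close> the density bound holds at one common scale, so each sufficiently
  small ball meeting \<open>F n\<close> has \<mu> at most \<open>t\<close> times its
  \<open>zeta_b\<close>, and summing over a cover bounds \<open>\<mu> (F n)\<close>. The sets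
  \<open>F n\<close> increase to \<open>E\<close> without being known to be measurable, so the limit
  relies on regularity of \<mu>.\<close>

lemma measure_le_spherical:
  assumes \<mu>: "measure_over \<mu>" and "regular_measure \<mu>" and c: "0 < c" and t: "t < \<infinity>"
    and less: "\<And>x. x \<in> E \<Longrightarrow> Federer_density c \<alpha> \<mu> x < t"
  shows "\<mu> E \<le> t * spherical_measure c \<alpha> E"
proof -
  let ?h = "\<lambda>n. density_below c \<alpha> \<mu> (1 / real (Suc n))"
  define F where "F n = {x\<in>E. ?h n x < t}" for n
  \<comment> \<open>Covers admit diameters equal to their scale while the density asks for strictly
    smaller ones, hence the next smaller scale.\<close>
  have le: "\<mu> (F n) \<le> t * spherical_premeasure c \<alpha> (1 / real (Suc (Suc n))) (F n)" for n
  proof (cases "t = 0")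
    case True
    then show ?thesis by (simp add: F_def measure_over_empty[OF \<mu>])
  next
    case False
    let ?p = "spherical_premeasure c \<alpha> (1 / real (Suc (Suc n))) (F n)"
    show ?thesis
    proof (rule ccontr)
      assume "\<not> ?thesis"
      then have "?p < \<mu> (F n) / t"
        using False t by (simp add: less_divide_ennreal_iff mult.commute)
      then obtain S where S: "\<And>j::nat. S j \<noteq> {} \<Longrightarrow> S j \<in> closed_balls \<and> diameter (S j) \<le> 1 / real (Suc (Suc n))"
          and cov: "F n \<subseteq> (\<Union>j. S j)" and sum: "(\<Sum>j. zeta_b c \<alpha> (S j)) < \<mu> (F n) / t"
        by (erule spherical_premeasure_lessE)
      have "\<mu> (S j \<inter> F n) \<le> t * zeta_b c \<alpha> (S j)" for j
      proof (cases "S j \<inter> F n = {}")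
        case True
        then show ?thesis by (simp add: measure_over_empty[OF \<mu>])
      next
        case ne: False
        then obtain x where x: "x \<in> S j" "x \<in> F n" by auto
        have step: "1 / real (Suc (Suc n)) < 1 / real (Suc n)"
          by (intro divide_strict_left_mono) auto
        have ball: "S j \<in> closed_balls" and diam: "diameter (S j) < 1 / real (Suc n)"
          using S[of j] x(1) step by (auto intro: le_less_trans)
        have "\<mu> (S j) \<le> t * zeta_b c \<alpha> (S j)"
        proof (cases "S j \<in> admissible_balls \<mu> (zeta_b c \<alpha>)")
          case True
          then have "quotient_fun \<mu> (zeta_b c \<alpha>) (S j) \<le> ?h n x"
            unfolding density_below_def using x(1) diam by (intro SUP_upper) auto
          also have "\<dots> < t" using x(2) by (simp add: F_def)
          finally have Q: "quotient_fun \<mu> (zeta_b c \<alpha>) (S j) < t" .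
          \<comment> \<open>Where \<open>zeta_b\<close> vanishes the quotient is infinite, which the
            strict bound excludes.\<close>
          then have "zeta_b c \<alpha> (S j) \<noteq> 0" by (auto simp: quotient_fun_def)
          then show ?thesis using Q by (simp flip: quotient_fun_le_iff)
        next
          case False
          \<comment> \<open>A closed ball that is not admissible is \<mu>-null here, because
            \<open>zeta_b\<close> is never infinite.\<close>
          then show ?thesis using ball by (auto simp: admissible_balls_def zeta_b_def)
        qed
        then show ?thesis
          using measure_over_mono[OF \<mu>, of "S j \<inter> F n" "S j"] by auto
      qed
      then have "(\<Sum>j. \<mu> (S j \<inter> F n)) \<le> (\<Sum>j. t * zeta_b c \<alpha> (S j))"
        by (intro suminf_le) auto
      moreover have "\<mu> (F n) \<le> (\<Sum>j. \<mu> (S j \<inter> F n))"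
      proof -
        have "\<mu> (F n) \<le> \<mu> (\<Union>j. S j \<inter> F n)" using cov by (intro measure_over_mono[OF \<mu>]) blast
        then show ?thesis using measure_over_subadditive[OF \<mu>] order_trans by blast
      qed
      ultimately have "\<mu> (F n) \<le> t * (\<Sum>j. zeta_b c \<alpha> (S j))" by simp
      moreover have "t * (\<Sum>j. zeta_b c \<alpha> (S j)) < \<mu> (F n)"
        using sum False t by (simp add: less_divide_ennreal_iff mult.commute)
      ultimately show False by simp
    qed
  qed
  have mono: "?h (Suc n) x \<le> ?h n x" for n x
    by (intro density_below_mono divide_left_mono) auto
  have "incseq F"
    unfolding F_def by (intro incseq_SucI) (use mono le_less_trans in blast)
  moreover have "\<mu> (F n) \<le> t * spherical_measure c \<alpha> E" for n
  proof -
    have "spherical_premeasure c \<alpha> (1 / real (Suc (Suc n))) (F n) \<le> spherical_measure c \<alpha> (F n)"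
      by (rule spherical_premeasure_le_measure) simp
    also have "\<dots> \<le> spherical_measure c \<alpha> E"
      by (intro measure_over_mono[OF measure_over_spherical]) (auto simp: F_def)
    finally show ?thesis using le[of n] by (meson mult_left_mono order_trans zero_le)
  qed
  ultimately have "\<mu> (\<Union>n. F n) \<le> t * spherical_measure c \<alpha> E"
    by (rule regular_measure_incseq_le[OF \<mu> assms(2)])
  moreover have "E \<subseteq> (\<Union>n. F n)"
    using less unfolding F_def Federer_density_eq_INF[where m = 0] INF_less_iff
    by fastforce
  ultimately show ?thesis using measure_over_mono[OF \<mu>] order_trans by blast
qed

section \<open>Outer regularity of Borel measures\<close>

lemma emeasure_decseq_empty_less:
  assumes "\<And>n. D n \<in> sets M" and "decseq D" and "(\<Inter>n. D n) = {}"
    and "\<And>n. emeasure M (D n) < \<infinity>" and "(0::ennreal) < e"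
  shows "\<exists>n::nat. emeasure M (D n) < e"
proof -
  have "(\<lambda>n. emeasure M (D n)) \<longlonglongrightarrow> emeasure M (\<Inter>n. D n)"
    using assms(1,2,4) by (intro Lim_emeasure_decseq) (auto simp: less_top)
  then have "(\<lambda>n. emeasure M (D n)) \<longlonglongrightarrow> 0" using assms(3) by simp
  then have "eventually (\<lambda>n. emeasure M (D n) < e) sequentially"
    using assms(5) by (rule order_tendstoD(2))
  then show ?thesis by (auto dest: eventually_happens)
qed

text \<open>Approximating from inside and outside at once makes the property stable under
  complements, so induction over the generated sigma-algebra applies. The error is measured inside
  \<open>U\<close>, whose finite measure permits continuity from above.\<close>

lemma borel_closed_open_approx:
  fixes M :: "'a::metric_space measure"
  assumes sets: "sets borel \<subseteq> sets M" and U: "U \<in> sets borel" "emeasure M U < \<infinity>"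
    and "B \<in> sets borel" and "0 < e"
  shows "\<exists>C V. closed C \<and> open V \<and> C \<subseteq> B \<and> B \<subseteq> V \<and> emeasure M (U \<inter> (V - C)) < ennreal e"
proof -
  have in_M: "T \<in> sets borel \<Longrightarrow> T \<in> sets M" for T using sets by auto
  have fin: "emeasure M (U \<inter> T) < \<infinity>" if "T \<in> sets borel" for T
    using emeasure_mono[of "U \<inter> T" U M] U by (auto intro: in_M le_less_trans)
  have shrink: "\<exists>n::nat. emeasure M (U \<inter> D n) < ennreal e"
    if "\<And>n. D n \<in> sets borel" "decseq D" "(\<Inter>n. D n) = {}" "0 < e" for D :: "nat \<Rightarrow> 'a set" and e
  proof (rule emeasure_decseq_empty_less)
    show "U \<inter> D n \<in> sets M" for n using that(1) U(1) by (intro in_M) auto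
    show "decseq (\<lambda>n. U \<inter> D n)" using that(2) by (auto simp: decseq_def)
    show "(\<Inter>n. U \<inter> D n) = {}" using that(3) by blast
    show "emeasure M (U \<inter> D n) < \<infinity>" for n by (rule fin[OF that(1)])
  qed (use that(4) in simp)
  have "B \<in> sigma_sets UNIV {S. open S}"
    using assms(4) by (simp add: borel_def)
  then show ?thesis using \<open>0 < e\<close>
  proof (induction arbitrary: e)
    case (Basic B)
    then have "open B" by simp
    show ?case
    \<comment> \<open>An open set is exhausted by the points at distance at least
      \<open>1/(n+1)\<close> from its complement; this fails for \<open>UNIV\<close>, since
      \<open>infdist\<close> to the empty set is 0.\<close>
    proof (cases "B = UNIV")
      case True
      then show ?thesis using Basic by (intro exI[of _ UNIV]) auto
    next
      case False
      define C where "C n = {x. 1 / real (Suc n) \<le> infdist x (- B)}" for n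
      have cl: "closed (C n)" for n
        unfolding C_def by (intro closed_Collect_le continuous_intros)
      have CB: "C n \<subseteq> B" for n
      proof
        fix x assume "x \<in> C n"
        then have "0 < infdist x (- B)" by (auto simp: C_def intro: less_le_trans[rotated])
        then show "x \<in> B" by (metis ComplI infdist_zero less_irrefl)
      qed
      have "\<exists>n. x \<in> C n" if "x \<in> B" for x
      proof -
        have "0 < infdist x (- B)"
          using that \<open>open B\<close> False by (intro infdist_pos_not_in_closed) (auto simp: closed_def)
        then obtain n where "1 / real (Suc n) < infdist x (- B)" by (rule nat_approx_posE)
        then show ?thesis by (auto simp: C_def intro!: exI[of _ n])
      qed
      then have "(\<Inter>n. B - C n) = {}" by blast
      moreover have "C n \<subseteq> C (Suc n)" for n
      proof -
        have "1 / real (Suc (Suc n)) \<le> 1 / real (Suc n)" by (intro divide_left_mono) auto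
        then show ?thesis by (auto simp: C_def intro: order_trans)
      qed
      then have "decseq (\<lambda>n. B - C n)" by (intro decseq_SucI) blast
      moreover have "B - C n \<in> sets borel" for n
        using \<open>open B\<close> cl[of n] by (intro sets.Diff) auto
      ultimately obtain n where "emeasure M (U \<inter> (B - C n)) < ennreal e"
        using shrink[of "\<lambda>n. B - C n" e] Basic(2) by blast
      then show ?thesis
        using cl CB \<open>open B\<close> by (intro exI[of _ "C n"] exI[of _ B]) auto
    qed
  next
    case Empty
    then show ?case by (intro exI[of _ "{}"]) auto
  next
    case (Compl B)
    obtain C V where CV: "closed C" "open V" "C \<subseteq> B" "B \<subseteq> V" "emeasure M (U \<inter> (V - C)) < ennreal e"
      using Compl.IH[OF Compl.prems] by (elim exE conjE)
    have "(- C) - (- V) = V - C" by auto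
    then show ?case
      using CV by (intro exI[of _ "- V"] exI[of _ "- C"]) auto
  next
    case (Union B)
    \<comment> \<open>Half of \<open>e\<close> is distributed over the sets \<open>B i\<close>. The
      other half pays for replacing the union of all \<open>C i\<close>, which need not be closed,
      by a finite union.\<close>
    have "\<exists>C V. closed C \<and> open V \<and> C \<subseteq> B i \<and> B i \<subseteq> V \<and>
        emeasure M (U \<inter> (V - C)) < ennreal (e / 2 * (1 / 2) ^ Suc i)" for i :: nat
      using Union.prems by (intro Union.IH) auto
    then have "\<exists>C. \<forall>i. \<exists>V. closed (C i) \<and> open V \<and> C i \<subseteq> B i \<and> B i \<subseteq> V \<and>
        emeasure M (U \<inter> (V - C i)) < ennreal (e / 2 * (1 / 2) ^ Suc i)"
      by (intro choice allI)
    then obtain C where "\<forall>i. \<exists>V. closed (C i) \<and> open V \<and> C i \<subseteq> B i \<and> B i \<subseteq> V \<and>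
        emeasure M (U \<inter> (V - C i)) < ennreal (e / 2 * (1 / 2) ^ Suc i)"
      by (elim exE)
    then have "\<exists>V. \<forall>i. closed (C i) \<and> open (V i) \<and> C i \<subseteq> B i \<and> B i \<subseteq> V i \<and>
        emeasure M (U \<inter> (V i - C i)) < ennreal (e / 2 * (1 / 2) ^ Suc i)"
      by (rule choice)
    then obtain V where "\<forall>i. closed (C i) \<and> open (V i) \<and> C i \<subseteq> B i \<and> B i \<subseteq> V i \<and>
        emeasure M (U \<inter> (V i - C i)) < ennreal (e / 2 * (1 / 2) ^ Suc i)"
      by (elim exE)
    then have CV: "\<And>i. closed (C i)" "\<And>i. open (V i)" "\<And>i. C i \<subseteq> B i" "\<And>i. B i \<subseteq> V i"
        "\<And>i. emeasure M (U \<inter> (V i - C i)) < ennreal (e / 2 * (1 / 2) ^ Suc i)"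
      by simp_all
    have borel: "C i \<in> sets borel" "V i \<in> sets borel" for i using CV by auto
    define F where "F n = (\<Union>i<n. C i)" for n
    have "(\<Inter>n. (\<Union>i. C i) - F n) = {}"
      unfolding F_def by auto
    moreover have "decseq (\<lambda>n. (\<Union>i. C i) - F n)"
      by (auto simp: F_def decseq_def)
    moreover have Fb: "F n \<in> sets borel" "(\<Union>i. C i) - F n \<in> sets borel" for n
      using borel by (auto simp: F_def)
    ultimately obtain n where n: "emeasure M (U \<inter> ((\<Union>i. C i) - F n)) < ennreal (e / 2)"
      using shrink[of "\<lambda>n. (\<Union>i. C i) - F n" "e / 2"] Union.prems by auto
    have "emeasure M (U \<inter> ((\<Union>i. V i) - F n))
        \<le> emeasure M ((\<Union>i. U \<inter> (V i - C i)) \<union> (U \<inter> ((\<Union>i. C i) - F n)))"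
      using borel Fb U(1) by (intro emeasure_mono in_M) auto
    also have "\<dots> \<le> emeasure M (\<Union>i. U \<inter> (V i - C i)) + emeasure M (U \<inter> ((\<Union>i. C i) - F n))"
      using borel Fb U(1) by (intro emeasure_subadditive in_M) auto
    also have "emeasure M (\<Union>i. U \<inter> (V i - C i)) \<le> (\<Sum>i. emeasure M (U \<inter> (V i - C i)))"
      using borel U(1) by (intro emeasure_subadditive_countably) (auto intro!: in_M)
    also have "\<dots> \<le> (\<Sum>i. ennreal (e / 2 * (1 / 2) ^ Suc i))"
      by (intro suminf_le less_imp_le CV) auto
    also have "\<dots> = ennreal (e / 2)"
      using Union.prems sums_mult[OF power_half_series, of "e / 2"] by (intro suminf_ennreal_eq) auto
    also have "ennreal (e / 2) + emeasure M (U \<inter> ((\<Union>i. C i) - F n)) < ennreal (e / 2) + ennreal (e / 2)"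
      using n by (simp add: ennreal_add_left_cancel_less)
    also have "\<dots> = ennreal e" using Union.prems by (simp flip: ennreal_plus)
    finally have "emeasure M (U \<inter> ((\<Union>i. V i) - F n)) < ennreal e"
      by (simp add: add_right_mono)
    moreover have "closed (F n)" "open (\<Union>i. V i)" using CV by (auto simp: F_def)
    moreover have "F n \<subseteq> (\<Union>i. B i)" "(\<Union>i. B i) \<subseteq> (\<Union>i. V i)" using CV(3,4) unfolding F_def by blast+
    ultimately show ?case by blast
  qed
qed

lemma borel_outer_regular:
  fixes M :: "'a::metric_space measure"
  assumes "sets borel \<subseteq> sets M" and "open U" and "emeasure M U < \<infinity>"
    and "E \<in> sets borel" and "E \<subseteq> U" and "0 < e"
  obtains V where "open V" "E \<subseteq> V" "V \<subseteq> U" "emeasure M V \<le> emeasure M E + ennreal e"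
proof -
  obtain C V where CV: "closed C" "open V" "C \<subseteq> E" "E \<subseteq> V" "emeasure M (U \<inter> (V - C)) < ennreal e"
    using borel_closed_open_approx[OF assms(1) _ assms(3,4,6)] assms(2) by auto
  have in_M: "T \<in> sets borel \<Longrightarrow> T \<in> sets M" for T using assms(1) by auto
  have "U \<inter> (V - C) \<in> sets borel"
    using assms(2) CV by (intro sets.Int sets.Diff) auto
  then have "emeasure M (U \<inter> V) \<le> emeasure M (E \<union> U \<inter> (V - C))"
    using assms CV by (intro emeasure_mono) (auto intro!: in_M)
  also have "\<dots> \<le> emeasure M E + emeasure M (U \<inter> (V - C))"
    using assms(4) \<open>U \<inter> (V - C) \<in> _\<close> by (intro emeasure_subadditive in_M)
  also have "\<dots> \<le> emeasure M E + ennreal e" using CV by (intro add_left_mono) auto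
  finally show ?thesis
    using that[of "U \<inter> V"] assms CV by auto
qed

section \<open>Vitali covering and the lower estimate\<close>

text \<open>Balls are given as pairs because a set may be a ball for several centres and radii.
  Zorn's lemma yields a maximal disjoint \<open>D\<close> such that every ball of \<open>K\<close>
  meeting \<open>D\<close> meets a member of at least half its radius. If some ball missed
  \<open>D\<close>, one of nearly largest radius among those missing it could be added.\<close>

lemma vitali_closed_balls:
  fixes K :: "('a::metric_space \<times> real) set"
  assumes K: "\<And>p. p \<in> K \<Longrightarrow> 0 < snd p \<and> snd p \<le> R"
  obtains D where "D \<subseteq> K"
    and "\<And>p q. p \<in> D \<Longrightarrow> q \<in> D \<Longrightarrow> p \<noteq> q \<Longrightarrow> cball (fst p) (snd p) \<inter> cball (fst q) (snd q) = {}"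
    and "\<And>p. p \<in> K \<Longrightarrow> \<exists>q\<in>D. cball (fst p) (snd p) \<inter> cball (fst q) (snd q) \<noteq> {} \<and> snd p \<le> 2 * snd q"
proof -
  define meets :: "('a \<times> real) \<Rightarrow> ('a \<times> real) \<Rightarrow> bool"
    where "meets p q \<longleftrightarrow> cball (fst p) (snd p) \<inter> cball (fst q) (snd q) \<noteq> {}" for p q
  have sym: "meets p q \<longleftrightarrow> meets q p" for p q by (auto simp: meets_def)
  define \<F> where "\<F> = {D. D \<subseteq> K \<and> (\<forall>p\<in>D. \<forall>q\<in>D. p \<noteq> q \<longrightarrow> \<not> meets p q) \<and>
    (\<forall>p\<in>K. (\<exists>q\<in>D. meets p q) \<longrightarrow> (\<exists>q\<in>D. meets p q \<and> snd p \<le> 2 * snd q))}"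
  have "\<exists>D\<in>\<F>. \<forall>X\<in>\<F>. D \<subseteq> X \<longrightarrow> X = D"
  proof (rule subset_Zorn')
    fix \<C> assume chain: "subset.chain \<F> \<C>"
    then have C: "D \<in> \<F>" if "D \<in> \<C>" for D using that by (auto simp: subset.chain_def)
    have "\<not> meets p q" if pq: "p \<in> \<Union>\<C>" "q \<in> \<Union>\<C>" "p \<noteq> q" for p q
    proof -
      obtain D1 D2 where D: "D1 \<in> \<C>" "p \<in> D1" "D2 \<in> \<C>" "q \<in> D2" using pq by auto
      then have "D1 \<subseteq> D2 \<or> D2 \<subseteq> D1" using chain by (auto simp: subset.chain_def)
      then obtain D where "D \<in> \<C>" "p \<in> D" "q \<in> D" using D by blast
      then show ?thesis using C[of D] pq(3) unfolding \<F>_def by blast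
    qed
    moreover have "\<exists>q\<in>\<Union>\<C>. meets p q \<and> snd p \<le> 2 * snd q" if p: "p \<in> K" "\<exists>q\<in>\<Union>\<C>. meets p q" for p
    proof -
      obtain D q where "D \<in> \<C>" "q \<in> D" "meets p q" using p(2) by blast
      then show ?thesis using C[of D] p(1) unfolding \<F>_def by blast
    qed
    moreover have "\<Union>\<C> \<subseteq> K" using C unfolding \<F>_def by blast
    ultimately show "\<Union>\<C> \<in> \<F>" unfolding \<F>_def by blast
  qed
  then obtain D where D: "D \<in> \<F>" and max: "\<And>X. X \<in> \<F> \<Longrightarrow> D \<subseteq> X \<Longrightarrow> X = D" by blast
  have all: "\<exists>q\<in>D. meets p q" if "p \<in> K" for p
  proof (rule ccontr)
    assume not: "\<not> ?thesis"
    define N where "N = {p\<in>K. \<forall>q\<in>D. \<not> meets p q}"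
    have pN: "p \<in> N" using not that by (auto simp: N_def)
    have bdd: "bdd_above (snd ` N)" using K by (intro bdd_aboveI[of _ R]) (auto simp: N_def)
    have pos: "0 < Sup (snd ` N)"
      using cSUP_upper[OF pN bdd] K[OF that] by linarith
    have "Sup (snd ` N) / 2 < Sup (snd ` N)" using pos by simp
    \<comment> \<open>A radius above half the supremum suffices: any ball of \<open>N\<close> that
      meets \<open>g\<close> has at most twice its radius, so \<open>insert g D\<close> keeps the
      domination property.\<close>
    then obtain g where g: "g \<in> N" "Sup (snd ` N) / 2 < snd g"
      using less_cSUP_iff[OF _ bdd, of "Sup (snd ` N) / 2"] pN by blast
    have big: "snd p \<le> 2 * snd g" if "p \<in> N" for p
      using cSUP_upper[OF that bdd] g(2) by linarith
    have "insert g D \<in> \<F>"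
      unfolding \<F>_def
    proof (intro CollectI conjI ballI impI)
      show "insert g D \<subseteq> K" using D g(1) by (auto simp: \<F>_def N_def)
    next
      fix p q assume "p \<in> insert g D" "q \<in> insert g D" "p \<noteq> q"
      then show "\<not> meets p q"
        using D g(1) sym unfolding \<F>_def N_def by blast
    next
      fix p assume p: "p \<in> K" "\<exists>q\<in>insert g D. meets p q"
      show "\<exists>q\<in>insert g D. meets p q \<and> snd p \<le> 2 * snd q"
      proof (cases "p \<in> N")
        case True
        then have "meets p g" using p(2) unfolding N_def by blast
        then show ?thesis using big[OF True] by blast
      next
        case False
        then have "\<exists>q\<in>D. meets p q" using p(1) unfolding N_def by blast
        then show ?thesis using D p(1) unfolding \<F>_def by blast
      qed
    qed
    then have "g \<in> D" using max[of "insert g D"] by blast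
    moreover have "meets g g" using K[of g] g(1) by (auto simp: meets_def N_def)
    ultimately show False using g(1) by (auto simp: N_def)
  qed
  show ?thesis
  proof (rule that[of D])
    show "D \<subseteq> K" using D by (simp add: \<F>_def)
    show "cball (fst p) (snd p) \<inter> cball (fst q) (snd q) = {}" if "p \<in> D" "q \<in> D" "p \<noteq> q" for p q
      using D that unfolding \<F>_def meets_def by blast
    show "\<exists>q\<in>D. cball (fst p) (snd p) \<inter> cball (fst q) (snd q) \<noteq> {} \<and> snd p \<le> 2 * snd q" if "p \<in> K" for p
      using D that all[OF that] unfolding \<F>_def meets_def by blast
  qed
qed

text \<open>Finite subfamilies have total measure at most \<open>\<phi> V\<close>, so the measures
  form a summable family, and only countably many of its terms are nonzero. This takes the place of
  separability of the space.\<close>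

lemma countable_disjoint_positive:
  assumes "measure_over \<phi>" and sets: "\<And>p. p \<in> D \<Longrightarrow> S p \<in> carath_sets \<phi>"
    and disj: "\<And>p q. p \<in> D \<Longrightarrow> q \<in> D \<Longrightarrow> p \<noteq> q \<Longrightarrow> S p \<inter> S q = {}"
    and sub: "\<And>p. p \<in> D \<Longrightarrow> S p \<subseteq> V" and fin: "\<phi> V < \<infinity>" and pos: "\<And>p. p \<in> D \<Longrightarrow> 0 < \<phi> (S p)"
  shows "countable D"
proof -
  let ?M = "carath_measure \<phi>"
  have less: "\<phi> (S p) < top" if "p \<in> D" for p
    using measure_over_mono[OF assms(1) sub[OF that]] fin by (simp add: le_less_trans)
  have "(\<lambda>p. enn2real (\<phi> (S p))) summable_on D"
  proof (rule nonneg_bdd_above_summable_on)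
    show "bdd_above (sum (\<lambda>p. enn2real (\<phi> (S p))) ` {F. F \<subseteq> D \<and> finite F})"
    proof (rule bdd_aboveI2)
      fix F assume "F \<in> {F. F \<subseteq> D \<and> finite F}"
      then have F: "F \<subseteq> D" "finite F" by auto
      have U: "(\<Union>p\<in>F. S p) \<in> carath_sets \<phi>"
        using F sets by (simp flip: sets_carath_measure[OF assms(1)]) (blast intro: sets.finite_UN)
      have "(\<Sum>p\<in>F. \<phi> (S p)) = (\<Sum>p\<in>F. emeasure ?M (S p))"
        using F sets by (intro sum.cong refl emeasure_carath_measure[symmetric] assms(1)) auto
      also have "\<dots> = emeasure ?M (\<Union>p\<in>F. S p)"
      proof (rule sum_emeasure)
        show "disjoint_family_on S F"
          unfolding disjoint_family_on_def using F disj by blast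
      qed (use F sets in \<open>auto simp: sets_carath_measure[OF assms(1)]\<close>)
      also have "\<dots> = \<phi> (\<Union>p\<in>F. S p)"
        by (rule emeasure_carath_measure[OF assms(1) U])
      also have "\<dots> \<le> \<phi> V"
        using F sub by (intro measure_over_mono[OF assms(1)]) blast
      finally have "enn2real (\<Sum>p\<in>F. \<phi> (S p)) \<le> enn2real (\<phi> V)"
        using fin by (intro enn2real_mono) auto
      moreover have "enn2real (\<Sum>p\<in>F. \<phi> (S p)) = (\<Sum>p\<in>F. enn2real (\<phi> (S p)))"
        using less F(1) by (subst enn2real_sum) (auto simp: comp_def)
      ultimately show "(\<Sum>p\<in>F. enn2real (\<phi> (S p))) \<le> enn2real (\<phi> V)" by simp
    qed
  qed simp
  then have "countable {p\<in>D. enn2real (\<phi> (S p)) \<noteq> 0}" by (rule summable_countable_real)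
  also have "{p\<in>D. enn2real (\<phi> (S p)) \<noteq> 0} = D"
    using pos less by (force simp: enn2real_eq_0_iff)
  finally show ?thesis .
qed

text \<open>Disjoint balls inside \<open>V\<close> with \<open>t * zeta_b\<close> at most \<mu> have
  total cost controlled by \<open>\<mu> V\<close>. Finitely many of them, together with fivefold
  enlargements of the others, cover \<open>E\<close>, and the enlarged tail costs arbitrarily
  little. The hypothesis \<open>isol\<close> deals with balls of diameter 0, whose quotient is
  infinite whatever \<mu> is.\<close>

lemma spherical_le_measure_open:
  fixes \<mu> :: "'a::metric_space set \<Rightarrow> ennreal"
  assumes \<mu>: "measure_over \<mu>" and bor: "Borel_measure \<mu>" and c: "0 < c" and \<alpha>: "0 < \<alpha>"
    and V: "open V" "\<mu> V < \<infinity>" "E \<subseteq> V"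
    and dens: "\<And>x. x \<in> E \<Longrightarrow> t < Federer_density c \<alpha> \<mu> x"
    and isol: "\<And>x. x \<in> E \<Longrightarrow> {x} \<in> closed_balls \<Longrightarrow> \<mu> {x} = 0"
  shows "t * spherical_measure c \<alpha> E \<le> \<mu> V"
proof (cases "t = 0")
  case False
  let ?\<zeta> = "zeta_b c \<alpha>"
  have pre: "t * spherical_premeasure c \<alpha> \<delta> E \<le> \<mu> V" if \<delta>: "0 < \<delta>" for \<delta>
  proof -
    let ?B = "\<lambda>p::'a \<times> real. cball (fst p) (snd p)"
    let ?B5 = "\<lambda>p::'a \<times> real. cball (fst p) (5 * snd p)"
    \<comment> \<open>With the radius at most the diameter, the fivefold ball has diameter at most
      10 times the original one; the bound \<open>\<delta> / 10\<close> then keeps it within the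
      scale \<delta>.\<close>
    define K where "K = {p. 0 < snd p \<and> ?B p \<subseteq> V \<and> snd p \<le> diameter (?B p) \<and>
      diameter (?B p) \<le> \<delta> / 10 \<and> t * ?\<zeta> (?B p) \<le> \<mu> (?B p)}"
    have fine: "\<exists>p\<in>K. x \<in> ?B p \<and> ?B p \<subseteq> W" if x: "x \<in> E" and W: "open W" "x \<in> W" for x W
    proof -
      have "open (V \<inter> W)" "x \<in> V \<inter> W" using V W x by auto
      then obtain \<eta> where \<eta>: "0 < \<eta>" "cball x \<eta> \<subseteq> V \<inter> W"
        using open_contains_cball_eq by metis
      let ?\<epsilon> = "min \<eta> (\<delta> / 10)"
      have \<epsilon>: "0 < ?\<epsilon>" using \<eta>(1) \<delta> by simp
      have "t < density_below c \<alpha> \<mu> ?\<epsilon> x"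
        using dens[OF x] Federer_density_le_below[OF \<epsilon>] by (rule less_le_trans)
      then obtain S where S: "S \<in> admissible_balls \<mu> ?\<zeta>" "x \<in> S" "diameter S < ?\<epsilon>"
          "t < quotient_fun \<mu> ?\<zeta> S"
        unfolding density_below_def less_SUP_iff by blast
      have ball: "S \<in> closed_balls" using S(1) by (simp add: admissible_balls_def)
      \<comment> \<open>Otherwise \<open>S\<close> is \<open>{x}\<close>, so both
        \<open>zeta_b\<close> and, by \<open>isol\<close>, \<mu> vanish on it, and \<open>S\<close>
        is not admissible.\<close>
      have "0 < diameter S"
      proof (rule ccontr)
        assume "\<not> ?thesis"
        then have d0: "diameter S = 0" using diameter_ge_0[OF bounded_closed_balls[OF ball]] by simp
        then have "S = {x}" using S(2) by (intro diameter_eq_0_singleton bounded_closed_balls ball)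
        then have "\<mu> S = 0" using isol[OF x] ball by simp
        then show False using S(1) d0 by (simp add: admissible_balls_def zeta_b_eq_0_iff[OF c] ball)
      qed
      then obtain y r where r: "S = cball y r" "0 < r" "r \<le> diameter S"
        using closed_balls_radius[OF ball] by metis
      have "S \<subseteq> cball x \<eta>"
      proof
        fix z assume "z \<in> S"
        then have "dist x z \<le> diameter S"
          by (intro diameter_bounded_bound bounded_closed_balls ball S)
        then show "z \<in> cball x \<eta>" using S(3) by simp
      qed
      moreover have "t * ?\<zeta> S \<le> \<mu> S"
        using S(4) less_quotient_fun_iff[of c \<alpha> S t \<mu>] \<open>0 < diameter S\<close>
        by (simp add: zeta_b_eq_0_iff[OF c])
      ultimately have "(y, r) \<in> K" using r S(3) \<eta>(2) by (auto simp: K_def)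
      then show ?thesis using S(2) \<open>S \<subseteq> cball x \<eta>\<close> \<eta>(2) r(1) by (intro bexI[of _ "(y, r)"]) auto
    qed
    have "0 < snd p \<and> snd p \<le> \<delta> / 10" if "p \<in> K" for p
      using that by (auto simp: K_def)
    from vitali_closed_balls[OF this] obtain D where D: "D \<subseteq> K"
      and disj: "\<And>p q. p \<in> D \<Longrightarrow> q \<in> D \<Longrightarrow> p \<noteq> q \<Longrightarrow> ?B p \<inter> ?B q = {}"
      and vit: "\<And>p. p \<in> K \<Longrightarrow> \<exists>q\<in>D. ?B p \<inter> ?B q \<noteq> {} \<and> snd p \<le> 2 * snd q"
      by blast
    have meas: "?B p \<in> carath_sets \<mu>" for p
      using bor by (auto simp: Borel_measure_def)
    have "countable D"
    proof (rule countable_disjoint_positive[OF \<mu>, where S = ?B])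
      fix p assume "p \<in> D"
      then have p: "p \<in> K" using D by auto
      then have "?\<zeta> (?B p) \<noteq> 0" by (auto simp: K_def zeta_b_eq_0_iff[OF c])
      then have "0 < t * ?\<zeta> (?B p)" using False by (simp add: zero_less_iff_neq_zero)
      then show "0 < \<mu> (?B p)" using p by (auto simp: K_def)
      show "?B p \<subseteq> V" using p by (simp add: K_def)
    qed (use meas disj V in auto)
    \<comment> \<open>\<open>D\<close> may be finite, so it is enumerated along a set
      \<open>J\<close> of naturals, and the other indices are filled with empty sets.\<close>
    define J where "J = to_nat_on D ` D"
    define g where "g = from_nat_into D"
    have g: "g j \<in> D" if "j \<in> J" for j
      using that \<open>countable D\<close> by (auto simp: g_def J_def)
    have gj: "\<exists>j\<in>J. g j = p" if "p \<in> D" for p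
      using that \<open>countable D\<close> by (auto simp: g_def J_def)
    have inj: "g i \<noteq> g j" if "i \<in> J" "j \<in> J" "i \<noteq> j" for i j
      using that \<open>countable D\<close> by (auto simp: g_def J_def)
    define B where "B j = (if j \<in> J then ?B (g j) else {})" for j
    define B5 where "B5 j = (if j \<in> J then ?B5 (g j) else {})" for j
    have gK: "g j \<in> K" if "j \<in> J" for j using g[OF that] D by auto
    have Bb: "B j \<in> sets borel" for j by (simp add: B_def)
    have disjB: "disjoint_family B"
      unfolding disjoint_family_on_def B_def using disj g inj by simp
    have "t * (\<Sum>j. ?\<zeta> (B j)) = (\<Sum>j. t * ?\<zeta> (B j))" by simp
    also have "\<dots> \<le> (\<Sum>j. \<mu> (B j))"
      using gK by (intro suminf_le) (auto simp: B_def K_def measure_over_empty[OF \<mu>])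
    also have "\<dots> = (\<Sum>j. emeasure (carath_measure \<mu>) (B j))"
      by (intro suminf_cong emeasure_carath_borel[symmetric] \<mu> bor Bb)
    also have "\<dots> = emeasure (carath_measure \<mu>) (\<Union>j. B j)"
      using disjB
      by (intro suminf_emeasure image_subsetI sets_carath_measureI[OF \<mu> bor] Bb)
    also have "\<dots> = \<mu> (\<Union>j. B j)"
      using Bb by (intro emeasure_carath_borel \<mu> bor sets.countable_UN) auto
    also have "\<dots> \<le> \<mu> V"
      using gK by (intro measure_over_mono[OF \<mu>]) (auto simp: B_def K_def split: if_splits)
    finally have le: "t * (\<Sum>j. ?\<zeta> (B j)) \<le> \<mu> V" .
    \<comment> \<open>This is where \<open>t \<noteq> 0\<close> and the finite measure of
      \<open>V\<close> enter; it makes the tails of the enlarged family small.\<close>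
    have finB: "(\<Sum>j. ?\<zeta> (B j)) < \<infinity>"
      using le V(2) False by (auto simp: top.not_eq_extremum[symmetric] ennreal_mult_eq_top_iff top_unique)
    have diam5: "diameter (?B5 p) \<le> 10 * diameter (?B p)" if "p \<in> K" for p
      using diameter_cball_le[of "5 * snd p" "fst p"] that by (auto simp: K_def)
    have "?\<zeta> (?B5 p) \<le> ennreal (10 powr \<alpha>) * ?\<zeta> (?B p)" if "p \<in> K" for p
      by (rule zeta_b_le_scaled[OF c \<alpha>]) (simp_all add: diam5[OF that])
    then have "(\<Sum>j. ?\<zeta> (B5 j)) \<le> (\<Sum>j. ennreal (10 powr \<alpha>) * ?\<zeta> (B j))"
      by (intro suminf_le) (simp_all add: B_def B5_def gK)
    also have "\<dots> < \<infinity>" using finB by (simp add: ennreal_mult_less_top)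
    finally have finB5: "(\<Sum>j. ?\<zeta> (B5 j)) < \<infinity>" .
    have "spherical_premeasure c \<alpha> \<delta> E \<le> (\<Sum>j. ?\<zeta> (B j))"
    proof (rule ennreal_le_epsilon)
      fix e :: real assume "0 < e"
      then obtain n where n: "(\<Sum>j. ?\<zeta> (B5 (j + n))) < ennreal e"
        using ennreal_suminf_tail_less[OF finB5, of "ennreal e"] by auto
      let ?C = "\<lambda>j. if j < n then B j else B5 j"
      have "spherical_premeasure c \<alpha> \<delta> E \<le> (\<Sum>j. ?\<zeta> (?C j))"
      proof (rule spherical_premeasure_le)
        show "?C j \<in> closed_balls \<and> diameter (?C j) \<le> \<delta>" if "?C j \<noteq> {}" for j
        proof -
          have "j \<in> J" using that by (auto simp: B_def B5_def split: if_splits)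
          with gK diam5[of "g j"] \<delta> show ?thesis
            by (force simp: B_def B5_def K_def closed_balls_def)
        qed
        show "E \<subseteq> (\<Union>j. ?C j)"
        proof
          fix x assume x: "x \<in> E"
          show "x \<in> (\<Union>j. ?C j)"
          proof (cases "x \<in> (\<Union>j<n. B j)")
            case True
            then obtain j where "j < n" "x \<in> B j" by auto
            then show ?thesis by (intro UN_I[of j]) auto
          next
            case outside: False
            \<comment> \<open>A finite union of closed balls leaves room around \<open>x\<close> for
              a ball of \<open>K\<close> that avoids the first \<open>n\<close> balls; the selected
              ball that it meets must therefore have index at least \<open>n\<close>.\<close>
            have "closed (\<Union>j<n. B j)" by (intro closed_UN) (auto simp: B_def)
            then have "open (- (\<Union>j<n. B j))" "x \<in> - (\<Union>j<n. B j)"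
              using outside by (simp_all only: open_Compl Compl_iff not_False_eq_True)
            from fine[OF x this] obtain p where p: "p \<in> K" "x \<in> ?B p" "?B p \<subseteq> - (\<Union>j<n. B j)"
              by blast
            obtain q where q: "q \<in> D" "?B p \<inter> ?B q \<noteq> {}" "snd p \<le> 2 * snd q"
              using vit[OF p(1)] by blast
            obtain j where j: "j \<in> J" "g j = q" using gj[OF q(1)] by blast
            have "\<not> j < n"
            proof
              assume "j < n"
              then have "?B q \<subseteq> (\<Union>j<n. B j)" using j by (auto simp: B_def)
              then show False using p(3) q(2) by blast
            qed
            moreover obtain z where z: "dist (fst p) z \<le> snd p" "dist (fst q) z \<le> snd q"
              using q(2) by auto
            \<comment> \<open>The factor five: the right side is at most
              \<open>snd q + 2 * snd p\<close>, and \<open>snd p \<le> 2 * snd q\<close>.\<close>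
            have "dist (fst q) x \<le> dist (fst q) z + (dist (fst p) z + dist (fst p) x)"
              using dist_triangle[of "fst q" x z] dist_triangle3[of z x "fst p"] by linarith
            then have "x \<in> B5 j" using z p(2) q(3) j by (simp add: B5_def)
            ultimately show ?thesis by (intro UN_I[of j]) auto
          qed
        qed
      qed
      also have "\<dots> = (\<Sum>j. ?\<zeta> (?C (j + n))) + (\<Sum>j<n. ?\<zeta> (?C j))"
        by (rule suminf_offset) simp
      also have "\<dots> = (\<Sum>j. ?\<zeta> (B5 (j + n))) + (\<Sum>j<n. ?\<zeta> (B j))"
        by (intro arg_cong2[where f = "(+)"] suminf_cong sum.cong) auto
      also have "\<dots> \<le> ennreal e + (\<Sum>j. ?\<zeta> (B j))"
        using n by (intro add_mono sum_le_suminf) auto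
      finally show "spherical_premeasure c \<alpha> \<delta> E \<le> (\<Sum>j. ?\<zeta> (B j)) + ennreal e"
        by (simp add: add.commute)
    qed
    then show ?thesis using le by (meson mult_left_mono order_trans zero_le)
  qed
  show ?thesis
    unfolding spherical_measure_def SUP_mult_left_ennreal by (rule SUP_least) (simp add: pre)
qed simp

lemma spherical_le_measure:
  fixes \<mu> :: "'a::metric_space set \<Rightarrow> ennreal"
  assumes \<mu>: "measure_over \<mu>" and bor: "Borel_measure \<mu>" and c: "0 < c" and \<alpha>: "0 < \<alpha>"
    and U: "open U" "\<mu> U < \<infinity>" "E \<subseteq> U" and E: "E \<in> sets borel"
    and dens: "\<And>x. x \<in> E \<Longrightarrow> t < Federer_density c \<alpha> \<mu> x"
    and isol: "\<And>x. x \<in> E \<Longrightarrow> {x} \<in> closed_balls \<Longrightarrow> \<mu> {x} = 0"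
  shows "t * spherical_measure c \<alpha> E \<le> \<mu> E"
proof (rule ennreal_le_epsilon)
  fix e :: real assume e: "0 < e"
  let ?M = "carath_measure \<mu>"
  have sets: "sets borel \<subseteq> sets ?M" using bor by (simp add: Borel_measure_def sets_carath_measure[OF \<mu>])
  have em: "emeasure ?M T = \<mu> T" if "T \<in> sets borel" for T
    using that by (rule emeasure_carath_borel[OF \<mu> bor])
  obtain V where V: "open V" "E \<subseteq> V" "V \<subseteq> U" "emeasure ?M V \<le> emeasure ?M E + ennreal e"
    using borel_outer_regular[OF sets U(1) _ E U(3) e] U em by auto
  have "\<mu> V < \<infinity>" using measure_over_mono[OF \<mu> V(3)] U(2) by (rule le_less_trans)
  then have "t * spherical_measure c \<alpha> E \<le> \<mu> V"
    using V dens isol by (intro spherical_le_measure_open \<mu> bor c \<alpha>)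
  also have "\<dots> \<le> \<mu> E + ennreal e" using V E by (simp add: em)
  finally show "t * spherical_measure c \<alpha> E \<le> \<mu> E + ennreal e" .
qed

section \<open>The area formula\<close>

text \<open>Disjointing the countable cover lets the local inequalities be summed. The disjoint
  pieces are smaller than the members of the cover, so the local inequality is required for all
  Borel subsets.\<close>

lemma emeasure_le_on_cover:
  assumes "sets borel \<subseteq> sets M" "sets borel \<subseteq> sets N" and B: "B \<in> sets borel"
    and "countable \<E>" "\<E> \<subseteq> sets borel" "B \<subseteq> \<Union>\<E>"
    and le: "\<And>E F. E \<in> \<E> \<Longrightarrow> F \<in> sets borel \<Longrightarrow> F \<subseteq> E \<inter> B \<Longrightarrow> emeasure M F \<le> q * emeasure N F"
  shows "emeasure M B \<le> q * emeasure N B"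
proof (cases "\<E> = {}")
  case True
  then show ?thesis using assms(6) by simp
next
  case False
  define E where "E n = from_nat_into \<E> n \<inter> B" for n
  have E: "E n \<in> sets borel" for n
    unfolding E_def using from_nat_into[OF False, of n] assms(5) B by auto
  have D: "disjointed E n \<in> sets borel" for n
    using E sets.range_disjointed_sets[of E borel] by auto
  have "\<Union>\<E> = (\<Union>n. from_nat_into \<E> n)"
    using range_from_nat_into[OF False assms(4)] by simp
  moreover have "(\<Union>n. E n) = (\<Union>n. from_nat_into \<E> n) \<inter> B" unfolding E_def by blast
  ultimately have "(\<Union>n. E n) = B" using assms(6) by (simp only: Int_absorb1)
  then have UD: "(\<Union>n. disjointed E n) = B" by (simp add: UN_disjointed_eq)
  have "emeasure M B = (\<Sum>n. emeasure M (disjointed E n))"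
    unfolding UD[symmetric] using D assms(1)
    by (intro suminf_emeasure[symmetric] disjoint_family_disjointed) auto
  also have "\<dots> \<le> (\<Sum>n. q * emeasure N (disjointed E n))"
  proof (intro suminf_le le D)
    show "from_nat_into \<E> n \<in> \<E>" for n by (rule from_nat_into[OF False])
    show "disjointed E n \<subseteq> from_nat_into \<E> n \<inter> B" for n
      using disjointed_subset[of E n] by (simp add: E_def)
  qed auto
  also have "\<dots> = q * emeasure N B"
    unfolding UD[symmetric] using D assms(2)
    by (subst suminf_emeasure[symmetric]) (auto simp: disjoint_family_disjointed)
  finally show ?thesis .
qed

section \<open>Limiting arguments with real factors\<close>

lemma ennreal_le_mult_greater_one:
  fixes x y :: ennreal
  assumes "\<And>q::real. 1 < q \<Longrightarrow> x \<le> ennreal q * y"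
  shows "x \<le> y"
proof (rule ennreal_le_epsilon)
  fix e :: real assume "y < top" and e: "0 < e"
  then obtain r where r: "y = ennreal r" "0 \<le> r" by (cases y) auto
  \<comment> \<open>Chosen so that \<open>?q * r \<le> r + e\<close>; the summand 1 in the
    denominator covers \<open>r = 0\<close>.\<close>
  let ?q = "1 + e / (r + 1)"
  have "x \<le> ennreal ?q * y" using e r by (intro assms) simp
  also have "\<dots> = ennreal (?q * r)" using e r by (simp add: ennreal_mult)
  also have "\<dots> \<le> ennreal (r + e)"
    using e r by (intro ennreal_leI) (simp add: field_simps)
  also have "\<dots> = y + ennreal e" using e r by simp
  finally show "x \<le> y + ennreal e" .
qed

lemma ennreal_eq_0_if_mult_bounded:
  fixes x C :: ennreal
  assumes "C < \<infinity>" and "\<And>t::real. 0 < t \<Longrightarrow> ennreal t * x \<le> C"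
  shows "x = 0"
proof (rule ccontr)
  assume "x \<noteq> 0"
  obtain m where m: "C = ennreal m" "0 \<le> m" using assms(1) by (cases C) auto
  have "x \<noteq> top" using assms(2)[of 1] assms(1) by auto
  then obtain p where p: "x = ennreal p" "0 < p"
    using \<open>x \<noteq> 0\<close> by (cases x) (auto simp: less_le)
  have "ennreal ((m + 1) / p) * x \<le> C" using m p by (intro assms) simp
  also have "ennreal ((m + 1) / p) * x = ennreal (m + 1)"
    using m p by (simp flip: ennreal_mult)
  finally show False using m by simp
qed

lemma ennreal_eq_0_if_le_mult:
  fixes x C :: ennreal
  assumes "C < \<infinity>" and "\<And>t::real. 0 < t \<Longrightarrow> x \<le> ennreal t * C"
  shows "x = 0"
proof -
  have "x \<le> 0"
  proof (rule ennreal_le_epsilon)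
    fix e :: real assume e: "0 < e"
    obtain r where r: "C = ennreal r" "0 \<le> r" using assms(1) by (cases C) auto
    have "x \<le> ennreal (e / (r + 1)) * C" using e r by (intro assms) simp
    also have "\<dots> = ennreal (e / (r + 1) * r)"
      unfolding r(1) using e r by (intro ennreal_mult[symmetric]) auto
    also have "\<dots> \<le> ennreal e" using e r by (intro ennreal_leI) (simp add: field_simps)
    finally show "x \<le> 0 + ennreal e" by simp
  qed
  then show ?thesis by simp
qed

text \<open>Rational endpoints make the later decomposition by density values countable. Taking
  \<open>a\<close> above \<open>v / q\<close> gives \<open>v < q * a\<close>, which leaves room for
  \<open>b\<close>.\<close>

lemma ex_rat_between_ratio:
  fixes v q :: real
  assumes "0 < v" "1 < q"
  shows "\<exists>a\<in>\<rat>. \<exists>b\<in>\<rat>. 0 < a \<and> b \<le> q * a \<and> a < v \<and> v < b"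
proof -
  have "v / q < v" using assms by (simp add: field_simps)
  then obtain a where a: "a \<in> \<rat>" "v / q < a" "a < v" by (rule Rats_dense_in_real[THEN bexE]) auto
  have "v < q * a" using a(2) assms by (simp add: field_simps)
  then obtain b where b: "b \<in> \<rat>" "v < b" "b < q * a" by (rule Rats_dense_in_real[THEN bexE]) auto
  have "0 < v / q" using assms by simp
  then have "0 < a" using a(2) by linarith
  then show ?thesis using a b by (intro bexI[of _ a] bexI[of _ b]) auto
qed

text \<open>The singleton covers itself at cost 0 at every scale. With absolute continuity, points
  of \<open>A\<close> that form a closed ball are \<mu>-null, which is the condition
  \<open>isol\<close> of the lower estimate.\<close>

lemma spherical_measure_singleton_ball:
  assumes "{x} \<in> closed_balls"
  shows "spherical_measure c \<alpha> {x} = 0"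
proof -
  have "spherical_premeasure c \<alpha> \<delta> {x} \<le> 0" if "0 < \<delta>" for \<delta>
  proof -
    have "spherical_premeasure c \<alpha> \<delta> {x} \<le> (\<Sum>j::nat. zeta_b c \<alpha> (if j = 0 then {x} else {}))"
      using assms that by (intro spherical_premeasure_le) (auto split: if_splits)
    also have "\<dots> = (\<Sum>j::nat. 0)" by (intro suminf_cong) (simp add: zeta_b_def)
    finally show ?thesis by simp
  qed
  then have "spherical_measure c \<alpha> {x} \<le> 0"
    unfolding spherical_measure_def by (intro SUP_least) simp
  then show ?thesis by simp
qed

theorem theorem5p7:
  fixes \<mu> :: "'a::metric_space set \<Rightarrow> ennreal" and \<alpha> c :: real and A :: "'a set"
  assumes "measure_over \<mu>" and "\<alpha> > 0" and "c > 0"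
    and "diametrically_regular TYPE('a)"
    and "regular_measure \<mu>" and "Borel_measure \<mu>"
    and "covers_finely (admissible_balls \<mu> (zeta_b c \<alpha>)) A"
    and "A \<in> sets borel"
    and "\<exists>\<U>. countable \<U> \<and> A \<subseteq> \<Union>\<U> \<and> (\<forall>U\<in>\<U>. open U \<and> \<mu> U < \<infinity>)"
    and "sigma_finite_set (spherical_measure c \<alpha>) {x \<in> A. Federer_density c \<alpha> \<mu> x = 0}"
    and "abs_continuous_on A \<mu> (spherical_measure c \<alpha>)"
  shows "Federer_density c \<alpha> \<mu> \<in> borel_measurable (restrict_space borel A) \<and>
    (\<forall>B\<in>sets borel. B \<subseteq> A \<longrightarrow>
       \<mu> B = (\<integral>\<^sup>+x\<in>B. Federer_density c \<alpha> \<mu> x \<partial>carath_measure (spherical_measure c \<alpha>)))"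
proof -
  let ?s = "Federer_density c \<alpha> \<mu>" and ?\<psi> = "spherical_measure c \<alpha> :: 'a set \<Rightarrow> ennreal"
  let ?M = "carath_measure \<mu>" and ?P = "carath_measure ?\<psi>"
  note \<mu> = assms(1) and \<alpha> = assms(2) and c = assms(3) and bor = assms(6)
  note \<psi> = measure_over_spherical[of c \<alpha>, where 'a = 'a] and bor\<psi> = Borel_measure_spherical[of c \<alpha>, where 'a = 'a]
  have s: "?s \<in> borel_measurable borel"
    by (rule Federer_density_measurable[OF \<mu> c \<alpha> assms(4)])
  have setsM: "sets borel \<subseteq> sets ?M" and setsP: "sets borel \<subseteq> sets ?P"
    using sets_carath_measureI[OF \<mu> bor] sets_carath_measureI[OF \<psi> bor\<psi>] by auto
  have sP: "?s \<in> borel_measurable ?P"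
    by (rule borel_measurable_subalgebra[OF setsP _ s]) simp
  \<comment> \<open>Writing the right side as a measure reduces the formula to comparing
    \<open>?M\<close> and \<open>?N\<close> on the members of a countable Borel cover.\<close>
  let ?N = "density ?P ?s"
  have N: "emeasure ?N F = (\<integral>\<^sup>+x\<in>F. ?s x \<partial>?P)" if "F \<in> sets borel" for F
    using that setsP sP by (intro emeasure_density) auto
  have M: "emeasure ?M F = \<mu> F" if "F \<in> sets borel" for F
    using that by (rule emeasure_carath_borel[OF \<mu> bor])
  have P: "emeasure ?P F = ?\<psi> F" if "F \<in> sets borel" for F
    using that by (rule emeasure_carath_borel[OF \<psi> bor\<psi>])
  have ac: "\<mu> F = 0" if "F \<subseteq> A" "?\<psi> F = 0" for F
    using assms(11) that by (auto simp: abs_continuous_on_def)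
  obtain \<U> where \<U>: "countable \<U>" "A \<subseteq> \<Union>\<U>" "\<And>U. U \<in> \<U> \<Longrightarrow> open U" "\<And>U. U \<in> \<U> \<Longrightarrow> \<mu> U < \<infinity>"
    using assms(9) by blast

  have upper: "\<mu> F \<le> ennreal t * ?\<psi> F" if "\<And>x. x \<in> F \<Longrightarrow> ?s x < ennreal t" for F t
    using that by (intro measure_le_spherical[OF \<mu> assms(5) c]) auto
  have lower: "t * ?\<psi> F \<le> \<mu> F"
    if "F \<in> sets borel" "F \<subseteq> A" "U \<in> \<U>" "F \<subseteq> U" "\<And>x. x \<in> F \<Longrightarrow> t < ?s x" for F U t
  proof (rule spherical_le_measure[OF \<mu> bor c \<alpha> \<U>(3,4)[OF that(3)] that(4,1,5)])
    fix x assume "x \<in> F" "{x} \<in> closed_balls"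
    then show "\<mu> {x} = 0" using that(2) by (intro ac spherical_measure_singleton_ball) auto
  qed

  have zero: "\<mu> F = 0 \<and> emeasure ?N F = 0"
    if F: "F \<in> sets borel" "F \<subseteq> A" "\<And>x. x \<in> F \<Longrightarrow> ?s x = 0" for F
  proof
    obtain \<W> where \<W>: "countable \<W>" "{x \<in> A. ?s x = 0} \<subseteq> \<Union>\<W>" "\<And>W. W \<in> \<W> \<Longrightarrow> ?\<psi> W < \<infinity>"
      using assms(10) unfolding sigma_finite_set_def by blast
    show "\<mu> F = 0"
    proof (rule measure_over_countable_null[OF \<mu> \<W>(1)])
      show "F \<subseteq> \<Union>\<W>" using F \<W>(2) by blast
      fix W assume W: "W \<in> \<W>"
      show "\<mu> (W \<inter> F) = 0"
      proof (rule ennreal_eq_0_if_le_mult[OF \<W>(3)[OF W]])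
        fix t :: real assume "0 < t"
        \<comment> \<open>The density is 0 here, so the upper estimate holds for every
          \<open>t > 0\<close>; the finite value \<open>?\<psi> W\<close> lets the bound tend to
          0.\<close>
        then have "\<mu> (W \<inter> F) \<le> ennreal t * ?\<psi> (W \<inter> F)" using F(3) by (intro upper) auto
        also have "\<dots> \<le> ennreal t * ?\<psi> W"
          by (intro mult_left_mono measure_over_mono[OF \<psi>]) auto
        finally show "\<mu> (W \<inter> F) \<le> ennreal t * ?\<psi> W" .
      qed
    qed
    have "(\<integral>\<^sup>+x\<in>F. ?s x \<partial>?P) = (\<integral>\<^sup>+x. 0 \<partial>?P)"
      using F(3) by (intro nn_integral_cong) (simp split: split_indicator)
    then show "emeasure ?N F = 0" by (simp add: N[OF F(1)])
  qed

  have infinite: "\<mu> F = 0 \<and> emeasure ?N F = 0"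
    if F: "F \<in> sets borel" "F \<subseteq> A" "U \<in> \<U>" "F \<subseteq> U" "\<And>x. x \<in> F \<Longrightarrow> ?s x = \<infinity>" for F U
  proof
    have "?\<psi> F = 0"
    proof (rule ennreal_eq_0_if_mult_bounded)
      show "\<mu> F < \<infinity>" using measure_over_mono[OF \<mu> F(4)] \<U>(4)[OF F(3)] by (rule le_less_trans)
      \<comment> \<open>Infinite density admits every finite \<open>t\<close>, while
        \<open>\<mu> F\<close> stays below the finite \<open>\<mu> U\<close>.\<close>
      show "ennreal t * ?\<psi> F \<le> \<mu> F" for t
        using F(5) by (intro lower[OF F(1-4)]) simp
    qed
    then show "\<mu> F = 0" by (rule ac[OF F(2)])
    have "F \<in> null_sets ?P" using \<open>?\<psi> F = 0\<close> F(1) setsP by (auto simp: null_sets_def P)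
    then show "emeasure ?N F = 0" by (simp add: N[OF F(1)] nn_integral_null_set)
  qed

  have finite: "\<mu> F \<le> ennreal q * emeasure ?N F \<and> emeasure ?N F \<le> ennreal q * \<mu> F"
    if F: "F \<in> sets borel" "F \<subseteq> A" "U \<in> \<U>" "F \<subseteq> U"
      and s: "\<And>x. x \<in> F \<Longrightarrow> ennreal a < ?s x" "\<And>x. x \<in> F \<Longrightarrow> ?s x < ennreal b"
      and ab: "0 < a" "b \<le> q * a" "1 < q" for F U a b q
  proof -
    have FP: "F \<in> sets ?P" using F(1) setsP by auto
    have "ennreal a * ?\<psi> F = (\<integral>\<^sup>+x. ennreal a * indicator F x \<partial>?P)"
      using FP by (simp add: nn_integral_cmult_indicator P[OF F(1)])
    also have "\<dots> \<le> emeasure ?N F"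
      unfolding N[OF F(1)] using s(1) by (intro nn_integral_mono) (auto split: split_indicator intro: less_imp_le)
    finally have Na: "ennreal a * ?\<psi> F \<le> emeasure ?N F" .
    have "emeasure ?N F \<le> (\<integral>\<^sup>+x. ennreal b * indicator F x \<partial>?P)"
      unfolding N[OF F(1)] using s(2) by (intro nn_integral_mono) (auto split: split_indicator intro: less_imp_le)
    also have "\<dots> = ennreal b * ?\<psi> F"
      using FP by (simp add: nn_integral_cmult_indicator P[OF F(1)])
    finally have Nb: "emeasure ?N F \<le> ennreal b * ?\<psi> F" .
    \<comment> \<open>Both \<open>\<mu> F\<close> and \<open>?N F\<close> lie between
      \<open>a\<close> and \<open>b\<close> times \<open>?\<psi> F\<close>, so each is at most
      \<open>q\<close> times the other.\<close>
    have "ennreal b \<le> ennreal q * ennreal a"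
      using ab by (simp flip: ennreal_mult)
    then have b: "ennreal b * ?\<psi> F \<le> ennreal q * (ennreal a * ?\<psi> F)"
      by (metis mult.assoc mult_right_mono zero_le)
    have "\<mu> F \<le> ennreal b * ?\<psi> F" using s(2) by (rule upper)
    also note b
    also have "ennreal q * (ennreal a * ?\<psi> F) \<le> ennreal q * emeasure ?N F"
      using Na by (rule mult_left_mono) simp
    finally have 1: "\<mu> F \<le> ennreal q * emeasure ?N F" .
    note Nb
    also note b
    also have "ennreal q * (ennreal a * ?\<psi> F) \<le> ennreal q * \<mu> F"
      using s(1) by (intro mult_left_mono lower[OF F]) auto
    finally show ?thesis using 1 by simp
  qed

  have approx: "\<mu> B \<le> ennreal q * emeasure ?N B \<and> emeasure ?N B \<le> ennreal q * \<mu> B"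
    if B: "B \<in> sets borel" "B \<subseteq> A" and q: "1 < q" for B q
  proof -
    \<comment> \<open>The cover consists of the zero set, the infinity set and countably many bands
      of ratio at most \<open>q\<close>. Each is intersected with the members of
      \<open>\<U>\<close>, since the lower estimate needs an open set of finite measure around the
      piece.\<close>
    define I where "I = {(a, b). a \<in> \<rat> \<and> b \<in> \<rat> \<and> 0 < a \<and> b \<le> q * a}"
    define L where "L = {{x. ?s x = 0}, {x. ?s x = \<infinity>}} \<union>
      (\<lambda>(a, b). {x. ennreal a < ?s x \<and> ?s x < ennreal b}) ` I"
    define \<E> where "\<E> = (\<lambda>(U, T). U \<inter> T) ` (\<U> \<times> L)"
    have "I \<subseteq> \<rat> \<times> \<rat>" by (auto simp: I_def)
    then have "countable I" using countable_rat by (meson countable_SIGMA countable_subset)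
    then have cE: "countable \<E>" unfolding \<E>_def L_def using \<U>(1) by auto
    have "T \<in> sets borel" if "T \<in> L" for T
      using that s unfolding L_def by auto
    then have sE: "\<E> \<subseteq> sets borel"
      unfolding \<E>_def using \<U>(3) by auto
    have "B \<subseteq> \<Union>\<E>"
    proof
      fix x assume "x \<in> B"
      then obtain U where U: "U \<in> \<U>" "x \<in> U" using B(2) \<U>(2) by blast
      have "\<exists>T\<in>L. x \<in> T"
      proof (cases "?s x")
        case (real v)
        show ?thesis
        proof (cases "v = 0")
          case False
          then obtain a b where "a \<in> \<rat>" "b \<in> \<rat>" "0 < a" "b \<le> q * a" "a < v" "v < b"
            using ex_rat_between_ratio[of v q] real q by auto
          then show ?thesis
            using real by (intro bexI[of _ "{x. ennreal a < ?s x \<and> ?s x < ennreal b}"])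
              (auto simp: L_def I_def ennreal_less_iff)
        qed (use real in \<open>auto simp: L_def\<close>)
      qed (auto simp: L_def)
      then show "x \<in> \<Union>\<E>" using U unfolding \<E>_def by blast
    qed
    note cover = B(1) cE sE this
    have local: "\<mu> F \<le> ennreal q * emeasure ?N F \<and> emeasure ?N F \<le> ennreal q * \<mu> F"
      if E: "E \<in> \<E>" and F: "F \<in> sets borel" "F \<subseteq> E \<inter> B" for E F
    proof -
      obtain U T where UT: "U \<in> \<U>" "T \<in> L" "E = U \<inter> T" using E unfolding \<E>_def by blast
      have FA: "F \<subseteq> A" "F \<subseteq> U" "F \<subseteq> T" using F(2) B(2) UT(3) by auto
      consider "T = {x. ?s x = 0}" | "T = {x. ?s x = \<infinity>}"
        | a b where "(a, b) \<in> I" "T = {x. ennreal a < ?s x \<and> ?s x < ennreal b}"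
        using UT(2) unfolding L_def by blast
      then show ?thesis
      proof cases
        case 1
        then have "\<mu> F = 0 \<and> emeasure ?N F = 0" using FA(3) by (intro zero[OF F(1) FA(1)]) auto
        then show ?thesis by simp
      next
        case 2
        then have "\<mu> F = 0 \<and> emeasure ?N F = 0"
          using FA(3) by (intro infinite[OF F(1) FA(1) UT(1) FA(2)]) auto
        then show ?thesis by simp
      next
        case 3
        then show ?thesis
          using FA(3) q
          by (intro finite[OF F(1) FA(1) UT(1) FA(2), where a = a and b = b]) (auto simp: I_def)
      qed
    qed
    have setsN: "sets borel \<subseteq> sets ?N" using setsP by simp
    have "emeasure ?M B \<le> ennreal q * emeasure ?N B"
      using local by (intro emeasure_le_on_cover[OF setsM setsN cover]) (simp add: M)
    moreover have "emeasure ?N B \<le> ennreal q * emeasure ?M B"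
      using local by (intro emeasure_le_on_cover[OF setsN setsM cover]) (simp add: M)
    ultimately show ?thesis by (simp add: M B)
  qed
  show ?thesis
  proof (intro conjI ballI impI)
    show "?s \<in> borel_measurable (restrict_space borel A)"
      using s by (rule measurable_restrict_space1)
    fix B :: "'a set" assume B: "B \<in> sets borel" "B \<subseteq> A"
    have "\<mu> B = emeasure ?N B"
    proof (rule antisym)
      show "\<mu> B \<le> emeasure ?N B"
        by (rule ennreal_le_mult_greater_one) (use approx[OF B] in blast)
      show "emeasure ?N B \<le> \<mu> B"
        by (rule ennreal_le_mult_greater_one) (use approx[OF B] in blast)
    qed
    then show "\<mu> B = (\<integral>\<^sup>+x\<in>B. ?s x \<partial>?P)" by (simp add: N[OF B(1)])
  qed
qed

end
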